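(* Let the Smoothness, Hessian, Gradient and LICQ Assumptions of the context hold for all $k\in\mathbb N$ for the iterates generated by the exact algorithm of the context. Choose $\beta_k=\eta/\sqrt K$ (with $\eta>0$) and $\alpha_k\in[\nu,\nu+\theta\beta_k]$, where $\theta>0$ and $$\nu\in\Big(0,\min\Big\{\frac{\sigma\kappa_v\kappa_c^{-1}}{2(\tau_{\min}L+\Gamma)\omega^2},\,1-\theta\kappa_\beta\Big\}\Big],\qquad \tau_{\min}:=\frac{(1-\sigma)\kappa_v\sigma_J}{\omega(\kappa_\beta\kappa_H\kappa_u+\kappa_g)}.$$ Then for any $K\in\mathbb N$, $$\frac1K\sum_{k=0}^{K-1}\mathbb E[\|c_k\|]\le\frac{2\kappa_2}{\nu\sigma\kappa_v\sigma_J^2K},$$ and $$\frac1K\sum_{k=0}^{K-1}\mathbb E\big[\|\nabla f(x_k)+J_k^Ty_k^{\mathrm{true}}\|^2\big]\le\frac{2\kappa_H^2\kappa_2}{\nu\eta\tau_{\min}\zeta\sqrt K}+\frac{4\kappa_2\kappa_H^2\kappa_0\kappa_J^2\kappa_c}{\nu\sigma\kappa_v\sigma_J^2\zeta K}.$$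
   Context: Problem: minimize $f(x)$ over $x\in\mathbb R^n$ subject to $c(x)=0$, with $f:\mathbb R^n\to\mathbb R$ (an expectation) and $c:\mathbb R^n\to\mathbb R^m$. $\|\cdot\|$ is the Euclidean norm (and induced matrix norm); $A^+$ is the Moore-Penrose pseudoinverse. $J(x)=\nabla c(x)^T\in\mathbb R^{m\times n}$, $c_k=c(x_k)$, $J_k=J(x_k)$, $f_0=f(x_0)$. Smoothness Assumption: there is an open convex set $\mathcal X\subset\mathbb R^n$ containing all iterates $x_k$; on $\mathcal X$, $f$ is continuously differentiable and bounded, $\nabla f$ is bounded and Lipschitz with constant $L>0$, $c$ is continuously differentiable and bounded, $J$ is bounded and Lipschitz with constant $\Gamma>0$. Consequently there are constants $f_{\inf}\in\mathbb R$, $\kappa_g,\kappa_c,\kappa_J>0$ with $f_{\inf}\le f(x_k)$, $\|\nabla f(x_k)\|\le\kappa_g$, $\|c_k\|\le\kappa_c$, $\|J_k\|\le\kappa_J$ for all $k$; these are fixed. Hessian Assumption: for all $k$, $H_k$ is a symmetric $n\times n$ matrix chosen independently from $g_k$, $\|H_k\|\le\kappa_H$, and there is $\zeta>0$ with $u^TH_ku\ge\zeta\|u\|^2$ for all $u\in\mathrm{Null}(J_k)$. Gradient Assumption: for all $k$, the stochastic gradient estimate $g_k$ satisfies $\mathbb E_k[g_k]=\nabla f(x_k)$ and $\mathbb E_k[\|g_k-\nabla f(x_k)\|^2]\le M$ for some $M>0$, where $\mathbb E_k$ is the conditional expectation given the history up to $x_k$ (under which $x_k,v_k,H_k,\beta_k$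 are treated as known). LICQ Assumption: for all $k$, $J_k$ has full row rank, and there is a constant $\sigma_J>0$ such that $\|J_k^Tc_k\|\ge\sigma_J\|c_k\|$ for all $k$. Exact algorithm: given $x_0$, at iteration $k$: (1) compute $v_k\in\mathrm{Range}(J_k^T)$, independently of $g_k$, as an approximate solution of $\min_v\frac12\|c_k+J_kv\|^2$ s.t. $\|v\|\le\omega\|J_k^Tc_k\|$ (with $\omega>0$ fixed) that is feasible and satisfies the Cauchy decrease condition $\|c_k\|-\|c_k+J_kv_k\|\ge\epsilon_v(\|c_k\|-\|c_k+\alpha_k^CJ_kv_k^C\|)$, where $\epsilon_v\in(0,1]$ is fixed, $v_k^C=-J_k^Tc_k$, and $\alpha_k^C$ minimizes $\frac12\|c_k+\alpha J_kv_k^C\|^2$ over $\alpha\le\omega$; (2) draw $g_k$ and let $u_k$ be the unique minimizer of $(g_k+H_kv_k)^Tu+\frac12u^TH_ku$ s.t. $J_ku=0$; (3) with a predefined $\beta_k>0$, $\beta_k\le\kappa_\beta$ for all $k$ ($\kappa_\beta>0$ a constant), set $d_k=\beta_ku_k+v_k$; (4) choose $\alpha_k>0$ and set $x_{k+1}=x_k+\alpha_kd_k$. The stepsize $\alpha_k$ may depend on $g_k$. True quantities: $u_k^{\mathrm{true}}$ is the minimizer of $(\nabla f(x_k)+H_kv_k)^Tu+\frac12u^TH_ku$ s.t. $J_ku=0$, and $y_k^{\mathrm{true}}:=-(J_k^T)^+(\nabla f(x_k)+H_kv_k+H_ku_k^{\mathrm{true}})$. Constants: $\sigma\in(0,1)$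 is fixed; $\kappa_v>0$ is a constant such that $\|c_k\|(\|c_k\|-\|c_k+J_kv_k\|)\ge\kappa_v\|J_k^Tc_k\|^2$ for all $k$ (such a constant exists under the Smoothness Assumption); $\kappa_u:=\zeta^{-1}(\kappa_g+\kappa_H\omega\kappa_J\kappa_c)$; $\kappa_0:=\omega^2(2\kappa_H+2\zeta^{-1}\kappa_H^2+\zeta)$; $\kappa_1:=\frac12(\tau_{\min}L+\Gamma)(\zeta^{-1}\kappa_H\kappa_u^2+\zeta^{-2}M)+\theta\kappa_g\tau_{\min}\zeta^{-1}\sqrt M+\theta^2(\tau_{\min}L+\Gamma)\omega^2\kappa_J^2\kappa_c^2$; $\kappa_2:=\tau_{\min}(f_0-f_{\inf})+\|c_0\|+\eta^2\kappa_1$. *)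

theory Defs
  imports "HOL-Probability.Probability"
begin

text \<open>The norm of the type \<^typ>\<open>real^'n^'m\<close> is the Frobenius norm, not the norm induced by
  the Euclidean norms.\<close>

definition induced_norm :: "real^'n^'m \<Rightarrow> real" where
  "induced_norm A = onorm ((*v) A)"

text \<open>The Moore-Penrose pseudoinverse: the unique solution of the four Penrose equations.\<close>

definition is_pseudoinverse :: "real^'n^'m \<Rightarrow> real^'m^'n \<Rightarrow> bool" where
  "is_pseudoinverse A B \<longleftrightarrow>
     A ** B ** A = A \<and> B ** A ** B = B \<and>
     transpose (A ** B) = A ** B \<and> transpose (B ** A) = B ** A"

definition pseudoinverse :: "real^'n^'m \<Rightarrow> real^'m^'n" where
  "pseudoinverse A = (THE B. is_pseudoinverse A B)"

definition smoothness_assumption ::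
  "(real^'n) set \<Rightarrow> (real^'n \<Rightarrow> real) \<Rightarrow> (real^'n \<Rightarrow> real^'n) \<Rightarrow>
   (real^'n \<Rightarrow> real^'m) \<Rightarrow> (real^'n \<Rightarrow> real^'n^'m) \<Rightarrow> real \<Rightarrow> real \<Rightarrow> bool" where
  "smoothness_assumption X f grad_f c J L \<Gamma> \<longleftrightarrow>
     open X \<and> convex X \<and> L > 0 \<and> \<Gamma> > 0 \<and>
     (\<forall>y\<in>X. GDERIV f y :> grad_f y) \<and> continuous_on X grad_f \<and>
     bounded (f ` X) \<and> bounded (grad_f ` X) \<and> L-lipschitz_on X grad_f \<and>
     (\<forall>y\<in>X. (c has_derivative (*v) (J y)) (at y)) \<and> continuous_on X J \<and>
     bounded (c ` X) \<and> bounded (J ` X) \<and>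
     (\<forall>y\<in>X. \<forall>z\<in>X. induced_norm (J y - J z) \<le> \<Gamma> * norm (y - z))"

text \<open>The arguments \<open>c\<close> and \<open>J\<close> of \<open>normal_step\<close> are the values of the constraint function and of
  its Jacobian at the current iterate. Every minimizer \<open>a\<close> gives the same vector \<open>a *\<^sub>R (J *v vC)\<close>,
  so the existential quantifier over Cauchy step lengths is not a choice.\<close>

definition normal_step ::
  "real \<Rightarrow> real \<Rightarrow> real^'m \<Rightarrow> real^'n^'m \<Rightarrow> real^'n \<Rightarrow> bool" where
  "normal_step \<omega> \<epsilon>\<^sub>v c J v \<longleftrightarrow>
     v \<in> range ((*v) (transpose J)) \<and>
     norm v \<le> \<omega> * norm (transpose J *v c) \<and>
     (let vC = - (transpose J *v c) in
      \<exists>a. is_arg_min (\<lambda>a. 1/2 * (norm (c + a *\<^sub>R (J *v vC)))\<^sup>2) (\<lambda>a. a \<le> \<omega>) a \<and>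
          norm c - norm (c + J *v v) \<ge> \<epsilon>\<^sub>v * (norm c - norm (c + a *\<^sub>R (J *v vC))))"

definition tangential_step ::
  "real^'n \<Rightarrow> real^'n^'n \<Rightarrow> real^'n^'m \<Rightarrow> real^'n \<Rightarrow> real^'n \<Rightarrow> bool" where
  "tangential_step g H J v u \<longleftrightarrow>
     is_arg_min (\<lambda>u. (g + H *v v) \<bullet> u + 1/2 * (u \<bullet> (H *v u))) (\<lambda>u. J *v u = 0) u"

text \<open>One realization of the algorithm: the sequences are the values of the random sequences at one
  outcome.\<close>

definition exact_algorithm ::
  "(real^'n \<Rightarrow> real^'m) \<Rightarrow> (real^'n \<Rightarrow> real^'n^'m) \<Rightarrow> real \<Rightarrow> real \<Rightarrow> (nat \<Rightarrow> real) \<Rightarrow> real^'n \<Rightarrow>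
   (nat \<Rightarrow> real^'n) \<Rightarrow> (nat \<Rightarrow> real^'n^'n) \<Rightarrow> (nat \<Rightarrow> real^'n) \<Rightarrow> (nat \<Rightarrow> real^'n) \<Rightarrow>
   (nat \<Rightarrow> real^'n) \<Rightarrow> (nat \<Rightarrow> real^'n) \<Rightarrow> (nat \<Rightarrow> real) \<Rightarrow> bool" where
  "exact_algorithm c J \<omega> \<epsilon>\<^sub>v \<beta> x\<^sub>0 x H v g u d \<alpha> \<longleftrightarrow>
     x 0 = x\<^sub>0 \<and>
     (\<forall>k. normal_step \<omega> \<epsilon>\<^sub>v (c (x k)) (J (x k)) (v k) \<and>
          tangential_step (g k) (H k) (J (x k)) (v k) (u k) \<and>
          d k = \<beta> k *\<^sub>R u k + v k \<and>
          \<alpha> k > 0 \<and>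
          x (Suc k) = x k + \<alpha> k *\<^sub>R d k)"

definition hessian_assumption ::
  "(real^'n \<Rightarrow> real^'n^'m) \<Rightarrow> real \<Rightarrow> real \<Rightarrow> (nat \<Rightarrow> real^'n) \<Rightarrow> (nat \<Rightarrow> real^'n^'n) \<Rightarrow> bool" where
  "hessian_assumption J \<kappa>\<^sub>H \<zeta> x H \<longleftrightarrow>
     (\<forall>k. transpose (H k) = H k \<and> induced_norm (H k) \<le> \<kappa>\<^sub>H \<and>
          (\<forall>u. J (x k) *v u = 0 \<longrightarrow> u \<bullet> (H k *v u) \<ge> \<zeta> * (norm u)\<^sup>2))"

definition licq_assumption ::
  "(real^'n \<Rightarrow> real^'m) \<Rightarrow> (real^'n \<Rightarrow> real^'n^'m) \<Rightarrow> real \<Rightarrow> (nat \<Rightarrow> real^'n) \<Rightarrow> bool" where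
  "licq_assumption c J \<sigma>\<^sub>J x \<longleftrightarrow>
     (\<forall>k. rank (J (x k)) = CARD('m) \<and>
          norm (transpose (J (x k)) *v c (x k)) \<ge> \<sigma>\<^sub>J * norm (c (x k)))"

text \<open>The sigma-algebra \<open>F k\<close> is the information available before \<open>g k\<close> is drawn. That \<open>H k\<close> and
  \<open>v k\<close> do not depend on \<open>g k\<close>, and are known under the conditional expectation, is expressed by
  their measurability with respect to \<open>F k\<close>.\<close>

definition history ::
  "'w measure \<Rightarrow> (nat \<Rightarrow> 'w measure) \<Rightarrow> (nat \<Rightarrow> 'w \<Rightarrow> real^'n) \<Rightarrow>
   (nat \<Rightarrow> 'w \<Rightarrow> real^'n^'n) \<Rightarrow> (nat \<Rightarrow> 'w \<Rightarrow> real^'n) \<Rightarrow> bool" where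
  "history P F x H v \<longleftrightarrow>
     filtration (space P) F \<and>
     (\<forall>k. subalgebra P (F k) \<and>
          x k \<in> borel_measurable (F k) \<and>
          H k \<in> borel_measurable (F k) \<and>
          v k \<in> borel_measurable (F k))"

text \<open>The conditional variance uses \<^const>\<open>nn_cond_exp\<close>, which is meaningful without prior
  integrability. The bound makes \<open>g k - grad_f (x k)\<close> square integrable, so that, \<open>grad_f (x k)\<close> being
  bounded, \<open>g k\<close> is integrable and the conditional mean is meaningful as well.\<close>

definition gradient_assumption ::
  "'w measure \<Rightarrow> (nat \<Rightarrow> 'w measure) \<Rightarrow> (real^'n \<Rightarrow> real^'n) \<Rightarrow> real \<Rightarrow>
   (nat \<Rightarrow> 'w \<Rightarrow> real^'n) \<Rightarrow> (nat \<Rightarrow> 'w \<Rightarrow> real^'n) \<Rightarrow> bool" where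
  "gradient_assumption P F grad_f M x g \<longleftrightarrow>
     (\<forall>k. g k \<in> borel_measurable P \<and>
          (\<forall>i. AE s in P. real_cond_exp P (F k) (\<lambda>s. g k s $ i) s = grad_f (x k s) $ i) \<and>
          (AE s in P. nn_cond_exp P (F k) (\<lambda>s. ennreal ((norm (g k s - grad_f (x k s)))\<^sup>2)) s
             \<le> ennreal M))"

end

theory Submission
  imports Defs
begin

text \<open>Write \<open>e\<close> for the gradient noise and \<open>\<phi> = \<tau>\<^sub>m\<^sub>i\<^sub>n f + \<parallel>c\<parallel>\<close> for the merit function.
  The tangential step is an affine function of the gradient estimate, with a self-adjoint linear part
  of norm at most \<open>1 / \<zeta>\<close>. A Taylor estimate therefore bounds the change of \<open>\<phi>\<close> in one
  iteration, for every outcome, by a multiple of \<open>u\<^sup>T H u\<close> (for the true tangential step \<open>u\<close>) and of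
  \<open>\<parallel>c\<parallel>\<close>, both with negative sign, plus \<open>\<beta>\<^sup>2 \<kappa>\<^sub>1\<close>, a multiple of \<open>\<parallel>e\<parallel>\<^sup>2 - M\<close>, and a term \<open>w \<bullet> e\<close>
  in which \<open>w\<close> is known before \<open>e\<close> is drawn. Taking expectations removes the noise and
  telescoping bounds the sums of the expectations of \<open>u\<^sup>T H u\<close> and \<open>\<parallel>c\<parallel>\<close>. Since \<open>v\<close> and \<open>u\<close> are
  orthogonal and the residual is \<open>- H (v + u)\<close>, its square is controlled by these two quantities.\<close>

section \<open>Linear algebra of the tangential problem\<close>

declare transpose_matrix_vector [simp del]

lemma norm_matrix_vector_le_induced_norm: "norm (A *v x) \<le> induced_norm A * norm x"
  unfolding induced_norm_def by (rule onorm) simp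

lemma induced_norm_nonneg: "0 \<le> induced_norm A"
  unfolding induced_norm_def by (rule onorm_pos_le) simp

lemma inner_matrix_vector_transpose: "x \<bullet> (A *v y) = (transpose A *v x) \<bullet> (y :: real^'n)"
  by (simp add: dot_lmul_matrix transpose_matrix_vector)

text \<open>The square of the left-hand side equals
  \<open>x \<bullet> (A *v (transpose A *v x))\<close>; Cauchy-Schwarz bounds it, and one factor
  \<open>norm (transpose A *v x)\<close> cancels. Hence a bound on \<open>J\<close> also serves for
  its transpose.\<close>

lemma norm_transpose_matrix_vector_le: "norm (transpose A *v x) \<le> induced_norm A * norm x"
proof (cases "transpose A *v x = 0")
  case True
  then show ?thesis by (simp add: induced_norm_nonneg)
next
  case False
  have "(norm (transpose A *v x))\<^sup>2 = x \<bullet> (A *v (transpose A *v x))"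
    by (simp add: inner_matrix_vector_transpose power2_norm_eq_inner)
  also have "\<dots> \<le> norm x * (induced_norm A * norm (transpose A *v x))"
    by (meson Cauchy_Schwarz_ineq2 abs_le_D1 mult_left_mono norm_ge_zero
        norm_matrix_vector_le_induced_norm order_trans)
  finally have "norm (transpose A *v x) * norm (transpose A *v x)
      \<le> norm (transpose A *v x) * (induced_norm A * norm x)"
    by (simp add: power2_eq_square algebra_simps)
  with False show ?thesis by simp
qed

lemma transpose_mult_eq_0_iff_of_full_rank:
  fixes J :: "real^'n^'m"
  assumes "rank J = CARD('m)"
  shows "transpose J *v y = 0 \<longleftrightarrow> y = 0"
proof -
  have "inj ((*v) (transpose J))"
    using assms by (simp add: full_rank_injective[symmetric] rank_transpose)
  then show ?thesis by (metis injD matrix_vector_mult_0_right)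
qed

text \<open>The quadratic form of \<open>J ** transpose J\<close> at \<open>y\<close> is the squared
  norm of \<open>transpose J *v y\<close>, so the Gram matrix has the same kernel as
  \<open>transpose J\<close>, which is trivial under full row rank.\<close>

lemma full_rank_gram_inverse:
  fixes J :: "real^'n^'m"
  assumes "rank J = CARD('m)"
  obtains G where "J ** transpose J ** G = mat 1" and "G ** (J ** transpose J) = mat 1"
proof -
  have "y = 0" if "(J ** transpose J) *v y = 0" for y
  proof -
    have "(transpose J *v y) \<bullet> (transpose J *v y) = y \<bullet> ((J ** transpose J) *v y)"
      by (simp add: inner_matrix_vector_transpose flip: matrix_vector_mul_assoc)
    with that show ?thesis
      by (simp add: transpose_mult_eq_0_iff_of_full_rank[OF assms])
  qed
  then have "invertible (J ** transpose J)"
    by (simp add: invertible_left_inverse matrix_left_invertible_ker)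
  with that show thesis by (auto simp: invertible_def)
qed

text \<open>With \<open>G\<close> the inverse Gram matrix, \<open>transpose J ** G ** J\<close> is
  the orthogonal projection onto the range of \<open>transpose J\<close>. The remainder
  \<open>w\<close> of \<open>r\<close> lies in the null space of \<open>J\<close>, so it is
  orthogonal both to \<open>r\<close> and to its projection, hence to itself. This is what supplies
  Lagrange multipliers.\<close>

lemma orthogonal_null_space_imp_range_transpose:
  fixes J :: "real^'n^'m"
  assumes "rank J = CARD('m)" and "\<And>w. J *v w = 0 \<Longrightarrow> r \<bullet> w = 0"
  obtains y where "r = transpose J *v y"
proof -
  obtain G where G: "J ** transpose J ** G = mat 1"
    using full_rank_gram_inverse[OF assms(1)] by blast
  define y where "y = G *v (J *v r)"
  define w where "w = r - transpose J *v y"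
  have "J *v (transpose J *v y) = (J ** transpose J ** G) *v (J *v r)"
    by (simp add: y_def matrix_vector_mul_assoc matrix_mul_assoc)
  then have Jw: "J *v w = 0"
    by (simp add: G w_def matrix_vector_mult_diff_distrib)
  have "w \<bullet> w = r \<bullet> w - y \<bullet> (J *v w)"
    by (subst inner_matrix_vector_transpose) (simp add: w_def inner_diff_left)
  with Jw assms(2) have "w = 0" by simp
  with that show thesis by (simp add: w_def)
qed

text \<open>Symmetry of the four products gives \<open>A ** B = A ** C\<close> and
  \<open>B ** A = C ** A\<close>; then \<open>B = B ** A ** B\<close> turns into
  \<open>C ** A ** C = C\<close>. Uniqueness makes the definite description in
  \<open>pseudoinverse\<close> usable.\<close>

lemma is_pseudoinverse_unique:
  assumes "is_pseudoinverse A B" and "is_pseudoinverse A C"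
  shows "B = C"
proof -
  have B: "A ** B ** A = A" "B ** A ** B = B" "transpose (A ** B) = A ** B"
      "transpose (B ** A) = B ** A"
    and C: "A ** C ** A = A" "C ** A ** C = C" "transpose (A ** C) = A ** C"
      "transpose (C ** A) = C ** A"
    using assms by (auto simp: is_pseudoinverse_def)
  have AB: "A ** B = A ** C"
  proof -
    have "A ** B = transpose (A ** C ** A ** B)"
      using B(3) C(1) by simp
    also have "\<dots> = transpose (A ** B) ** transpose (A ** C)"
      by (simp add: matrix_transpose_mul matrix_mul_assoc)
    also have "\<dots> = A ** C"
      using B(1,3) C(3) by (simp add: matrix_mul_assoc)
    finally show ?thesis .
  qed
  have BA: "B ** A = C ** A"
  proof -
    have "B ** A = transpose (B ** (A ** C ** A))"
      using B(4) C(1) by simp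
    also have "\<dots> = transpose (C ** A) ** transpose (B ** A)"
      by (simp add: matrix_transpose_mul matrix_mul_assoc)
    also have "\<dots> = C ** (A ** B ** A)"
      using B(4) C(4) by (simp add: matrix_mul_assoc)
    finally show ?thesis using B(1) by simp
  qed
  have "B = B ** A ** B" using B(2) by simp
  also have "\<dots> = C ** A ** C" by (metis AB BA matrix_mul_assoc)
  finally show ?thesis using C(2) by simp
qed

text \<open>Under full row rank the pseudoinverse of \<open>transpose J\<close> is
  \<open>G ** J\<close> with \<open>G\<close> the inverse Gram matrix, a left inverse of
  \<open>transpose J\<close>.\<close>

lemma transpose_mult_pseudoinverse:
  fixes J :: "real^'n^'m"
  assumes "rank J = CARD('m)"
  shows "transpose J *v (pseudoinverse (transpose J) *v (transpose J *v y)) = transpose J *v y"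
proof -
  obtain G where G: "J ** transpose J ** G = mat 1" "G ** (J ** transpose J) = mat 1"
    using full_rank_gram_inverse[OF assms] by blast
  define B where "B = G ** J"
  have BJ: "B ** transpose J = mat 1"
    using G(2) by (simp add: B_def matrix_mul_assoc)
  \<comment> \<open>The Gram matrix is symmetric, so transposing its right inverse gives a left
    inverse, which must again be \<open>G\<close>.\<close>
  have "transpose G ** (J ** transpose J) = mat 1"
    using arg_cong[OF G(1), of transpose] by (simp add: matrix_transpose_mul matrix_mul_assoc)
  then have sym: "transpose G = G"
    by (metis G(1) matrix_mul_assoc matrix_mul_lid matrix_mul_rid)
  have "is_pseudoinverse (transpose J) B"
    unfolding is_pseudoinverse_def
  proof (intro conjI)
    show "transpose J ** B ** transpose J = transpose J"
      by (simp add: BJ flip: matrix_mul_assoc)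
    show "B ** transpose J ** B = B"
      by (simp add: BJ)
    show "transpose (transpose J ** B) = transpose J ** B"
      by (simp add: B_def matrix_transpose_mul sym matrix_mul_assoc)
    show "transpose (B ** transpose J) = B ** transpose J"
      by (simp add: BJ)
  qed
  then have "pseudoinverse (transpose J) = B"
    unfolding pseudoinverse_def by (auto intro: is_pseudoinverse_unique)
  then show ?thesis
    by (simp add: BJ matrix_vector_mul_assoc flip: matrix_mul_assoc)
qed

text \<open>First-order condition of the tangential problem with linear term \<open>b\<close>, the
  multiplier being eliminated by testing only against the null space of \<open>J\<close>. In this
  form the condition is jointly linear in \<open>b\<close> and \<open>u\<close>.\<close>

definition stationary :: "real^'n^'n \<Rightarrow> real^'n^'m \<Rightarrow> real^'n \<Rightarrow> real^'n \<Rightarrow> bool" where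
  "stationary H J b u \<longleftrightarrow> J *v u = 0 \<and> (\<forall>w. J *v w = 0 \<longrightarrow> (b + H *v u) \<bullet> w = 0)"

lemma quadratic_nonneg_imp_linear_coeff_eq_0:
  fixes a b :: real
  assumes "\<And>t. 0 \<le> t * a + t\<^sup>2 * b"
  shows "a = 0"
proof (rule ccontr)
  assume "a \<noteq> 0"
  \<comment> \<open>At \<open>t = - (s * a)\<close> the polynomial equals
    \<open>s * a\<^sup>2 * (s * b - 1)\<close>; this \<open>s\<close> makes \<open>s * b < 1\<close>
    whatever the sign of \<open>b\<close>.\<close>
  define s where "s = 1 / (1 + \<bar>b\<bar>)"
  have s: "0 < s" "s * \<bar>b\<bar> < 1" by (auto simp: s_def field_simps)
  have "s * b < 1" using s by (smt (verit) abs_ge_self mult_left_mono)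
  then have "s * a\<^sup>2 * (s * b) < s * a\<^sup>2"
    using s \<open>a \<noteq> 0\<close> by (simp add: mult_less_cancel_left1)
  with assms[of "- (s * a)"] show False
    by (simp add: power2_eq_square algebra_simps)
qed

text \<open>Moving the minimizer along a direction \<open>w\<close> of the null space changes the
  objective by a quadratic polynomial in \<open>t\<close> without constant term. It is nonnegative
  for every \<open>t\<close>, so its linear coefficient vanishes; symmetry of \<open>H\<close>
  identifies that coefficient.\<close>

lemma tangential_step_imp_stationary:
  assumes "tangential_step g H J v u" and "transpose H = H"
  shows "stationary H J (g + H *v v) u"
  unfolding stationary_def
proof (intro conjI allI impI)
  show Ju: "J *v u = 0"
    using assms(1) by (simp add: tangential_step_def is_arg_min_def)
  fix w assume Jw: "J *v w = 0"
  let ?q = "\<lambda>u. (g + H *v v) \<bullet> u + 1/2 * (u \<bullet> (H *v u))"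
  show "(g + H *v v + H *v u) \<bullet> w = 0"
  proof (rule quadratic_nonneg_imp_linear_coeff_eq_0)
    fix t :: real
    have "J *v (u + t *\<^sub>R w) = 0"
      by (simp add: Ju Jw matrix_vector_right_distrib matrix_vector_mult_scaleR)
    then have "?q u \<le> ?q (u + t *\<^sub>R w)"
      using assms(1) unfolding tangential_step_def is_arg_min_linorder by blast
    moreover have "u \<bullet> (H *v w) = w \<bullet> (H *v u)"
      using inner_matrix_vector_transpose[of u H w] assms(2) by (simp add: inner_commute)
    ultimately show "0 \<le> t * ((g + H *v v + H *v u) \<bullet> w) + t\<^sup>2 * (1/2 * (w \<bullet> (H *v w)))"
      by (simp add: matrix_vector_right_distrib matrix_vector_mult_scaleR inner_left_distrib
          inner_right_distrib inner_commute[of _ w] power2_eq_square algebra_simps)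
  qed
qed

lemma stationary_inner_self:
  assumes "stationary H J b u"
  shows "u \<bullet> (H *v u) = - (b \<bullet> u)"
proof -
  have "(b + H *v u) \<bullet> u = 0"
    using assms by (simp add: stationary_def)
  then show ?thesis
    by (simp add: inner_left_distrib inner_commute[of u])
qed

text \<open>Testing the condition with \<open>u\<close> itself gives
  \<open>u \<bullet> (H *v u) = - (b \<bullet> u)\<close>; curvature bounds this from below,
  Cauchy-Schwarz from above.\<close>

lemma stationary_norm_le:
  assumes "stationary H J b u" and "\<zeta> * (norm u)\<^sup>2 \<le> u \<bullet> (H *v u)" and "\<zeta> > 0"
  shows "norm u \<le> norm b / \<zeta>"
proof (cases "u = 0")
  case False
  have "\<zeta> * (norm u)\<^sup>2 \<le> norm b * norm u"
    using assms stationary_inner_self[OF assms(1)] Cauchy_Schwarz_ineq2[of b u] by linarith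
  with False have "\<zeta> * norm u \<le> norm b" by (simp add: power2_eq_square)
  with assms(3) show ?thesis by (simp add: field_simps)
qed (use assms(3) in simp)

text \<open>Linearity of the condition. Applied to the stochastic and the true step, it shows that
  their difference solves the tangential problem whose linear term is the noise alone.\<close>

lemma stationary_diff:
  assumes "stationary H J b u" and "stationary H J b' u'"
  shows "stationary H J (b - b') (u - u')"
  unfolding stationary_def
proof (intro conjI allI impI)
  show "J *v (u - u') = 0"
    using assms by (simp add: stationary_def matrix_vector_mult_diff_distrib)
  fix w assume "J *v w = 0"
  with assms have "(b + H *v u) \<bullet> w = 0" "(b' + H *v u') \<bullet> w = 0"
    by (auto simp: stationary_def)
  then show "(b - b' + H *v (u - u')) \<bullet> w = 0"
    by (simp add: matrix_vector_mult_diff_distrib inner_left_distrib inner_diff_left)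
qed

text \<open>The solution operator of the tangential problem is self-adjoint.\<close>

lemma stationary_swap:
  assumes "stationary H J e u" and "stationary H J a w" and "transpose H = H"
  shows "a \<bullet> u = w \<bullet> e"
proof -
  have "e \<bullet> w + w \<bullet> (H *v u) = 0" "a \<bullet> u + u \<bullet> (H *v w) = 0"
    using assms unfolding stationary_def by (metis inner_commute inner_left_distrib)+
  moreover have "u \<bullet> (H *v w) = w \<bullet> (H *v u)"
    using inner_matrix_vector_transpose[of u H w] assms(3) by (simp add: inner_commute)
  ultimately show ?thesis
    by (simp add: inner_commute[of e])
qed

text \<open>Cramer's rule for the first-order system of the tangential problem: the solution is a
  rational function of the data, hence measurable.\<close>

definition kkt_vector :: "real^'n \<Rightarrow> real^'m \<Rightarrow> real^('n+'m)" where
  "kkt_vector u y = (\<chi> i. case i of Inl j \<Rightarrow> u $ j | Inr k \<Rightarrow> y $ k)"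

definition kkt_matrix :: "real^'n^'n \<Rightarrow> real^'n^'m \<Rightarrow> real^('n+'m)^('n+'m)" where
  "kkt_matrix H J = (\<chi> i. case i of
     Inl j \<Rightarrow> kkt_vector (H $ j) (transpose J $ j) | Inr k \<Rightarrow> kkt_vector (J $ k) 0)"

text \<open>Only the primal components of Cramer's formula, for the right-hand side
  \<open>(- b, 0)\<close>, are kept; the multiplier components are dropped.\<close>

definition kkt_solution :: "real^'n^'n \<Rightarrow> real^'n^'m \<Rightarrow> real^'n \<Rightarrow> real^'n" where
  "kkt_solution H J b =
     (\<chi> j. det (\<chi> i l. if l = Inl j then kkt_vector (- b) (0 :: real^'m) $ i
                      else kkt_matrix H J $ i $ l) / det (kkt_matrix H J))"

lemma kkt_vector_eq_iff: "kkt_vector u y = kkt_vector u' y' \<longleftrightarrow> u = u' \<and> y = y'"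
  by (auto simp: kkt_vector_def vec_eq_iff split: sum.splits)

lemma kkt_vector_surj: "\<exists>u y. z = kkt_vector u y"
  by (rule exI[of _ "\<chi> j. z $ Inl j"], rule exI[of _ "\<chi> k. z $ Inr k"])
     (auto simp: kkt_vector_def vec_eq_iff split: sum.splits)

lemma kkt_vector_0: "kkt_vector 0 0 = 0"
  by (auto simp: kkt_vector_def vec_eq_iff split: sum.splits)

lemma kkt_matrix_mult:
  "kkt_matrix H J *v kkt_vector u y = kkt_vector (H *v u + transpose J *v y) (J *v u)"
proof -
  have "(\<Sum>i\<in>(UNIV :: ('a + 'b) set). h i) = (\<Sum>j\<in>UNIV. h (Inl j)) + (\<Sum>k\<in>UNIV. h (Inr k))"
    for h :: "'a::finite + 'b::finite \<Rightarrow> real"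
    using sum.Plus[of UNIV UNIV h] by simp
  then show ?thesis
    by (auto simp: vec_eq_iff kkt_matrix_def kkt_vector_def matrix_vector_mult_def split: sum.splits)
qed

text \<open>For a kernel vector \<open>(u, y)\<close>, testing the first block row with
  \<open>u\<close> removes the multiplier term because \<open>J *v u = 0\<close>. Curvature then
  forces \<open>u = 0\<close>, and full row rank forces \<open>y = 0\<close>.\<close>

lemma det_kkt_matrix_nz:
  fixes J :: "real^'n^'m"
  assumes "rank J = CARD('m)" and "\<And>u. J *v u = 0 \<Longrightarrow> \<zeta> * (norm u)\<^sup>2 \<le> u \<bullet> (H *v u)" and "\<zeta> > 0"
  shows "det (kkt_matrix H J) \<noteq> 0"
proof -
  have "z = 0" if z: "kkt_matrix H J *v z = 0" for z
  proof -
    obtain u y where uy: "z = kkt_vector u y"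
      using kkt_vector_surj by blast
    with z have Ju: "J *v u = 0" and 1: "H *v u + transpose J *v y = 0"
      by (auto simp: kkt_matrix_mult kkt_vector_eq_iff simp flip: kkt_vector_0)
    have "u \<bullet> (H *v u) = (H *v u + transpose J *v y) \<bullet> u - y \<bullet> (J *v u)"
      by (simp add: inner_matrix_vector_transpose[of y] inner_left_distrib inner_commute[of u])
    with 1 Ju have "u \<bullet> (H *v u) = 0" by simp
    with assms(2)[OF Ju] assms(3) have "u = 0"
      by (smt (verit) mult_pos_pos norm_eq_zero zero_less_power2)
    with 1 assms(1) have "y = 0"
      by (simp add: transpose_mult_eq_0_iff_of_full_rank)
    with uy \<open>u = 0\<close> show ?thesis by (simp add: kkt_vector_0)
  qed
  then show ?thesis
    by (subst invertible_det_nz[symmetric])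
       (simp add: invertible_left_inverse matrix_left_invertible_ker)
qed

text \<open>Orthogonality to the null space amounts to the existence of a multiplier, so the
  condition is solvability of a nonsingular block system. The equivalence provides existence,
  uniqueness and an explicit formula at once.\<close>

lemma stationary_iff_kkt_solution:
  fixes J :: "real^'n^'m"
  assumes "rank J = CARD('m)" and "\<And>u. J *v u = 0 \<Longrightarrow> \<zeta> * (norm u)\<^sup>2 \<le> u \<bullet> (H *v u)" and "\<zeta> > 0"
  shows "stationary H J b u \<longleftrightarrow> u = kkt_solution H J b"
proof -
  have cramer_iff: "kkt_matrix H J *v z = kkt_vector (- b) 0 \<longleftrightarrow>
      z = (\<chi> k. det (\<chi> i l. if l = k then kkt_vector (- b) (0 :: real^'m) $ i
                            else kkt_matrix H J $ i $ l) / det (kkt_matrix H J))" for z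
    by (rule cramer) (rule det_kkt_matrix_nz[OF assms])
  have "stationary H J b u \<longleftrightarrow> (\<exists>y. kkt_matrix H J *v kkt_vector u y = kkt_vector (- b) 0)"
  proof
    assume st: "stationary H J b u"
    then obtain y where "b + H *v u = transpose J *v y"
      using orthogonal_null_space_imp_range_transpose[OF assms(1)] stationary_def by metis
    moreover have "transpose J *v (- y) = - (transpose J *v y)"
      using matrix_vector_mult_diff_distrib[of "transpose J" 0 y] by simp
    ultimately have "H *v u + transpose J *v (- y) = - b"
      by (simp add: algebra_simps)
    with st show "\<exists>y. kkt_matrix H J *v kkt_vector u y = kkt_vector (- b) 0"
      by (metis kkt_matrix_mult stationary_def)
  next
    assume "\<exists>y. kkt_matrix H J *v kkt_vector u y = kkt_vector (- b) 0"
    then obtain y where y: "H *v u + transpose J *v y = - b" "J *v u = 0"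
      by (auto simp: kkt_matrix_mult kkt_vector_eq_iff)
    then have "b + H *v u = - (transpose J *v y)" by (simp add: algebra_simps eq_neg_iff_add_eq_0)
    then show "stationary H J b u"
      using y(2) by (simp add: stationary_def flip: inner_matrix_vector_transpose)
  qed
  also have "\<dots> \<longleftrightarrow> u = kkt_solution H J b"
  proof -
    obtain u' y' where s: "(\<chi> k. det (\<chi> i l. if l = k then kkt_vector (- b) (0 :: real^'m) $ i
                            else kkt_matrix H J $ i $ l) / det (kkt_matrix H J)) = kkt_vector u' y'"
      using kkt_vector_surj by blast
    have "u' = kkt_solution H J b"
    proof (rule vec_eq_iff[THEN iffD2], rule allI)
      fix j
      show "u' $ j = kkt_solution H J b $ j"
        using arg_cong[OF s, of "\<lambda>z. z $ Inl j"] by (simp add: kkt_vector_def kkt_solution_def)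
    qed
    then show ?thesis
      unfolding cramer_iff s kkt_vector_eq_iff by auto
  qed
  finally show ?thesis .
qed

section \<open>Measurability of the solution\<close>

lemma borel_measurable_vec_iff:
  fixes h :: "'a \<Rightarrow> real^'n"
  shows "h \<in> borel_measurable F \<longleftrightarrow> (\<forall>i. (\<lambda>s. h s $ i) \<in> borel_measurable F)"
  by (subst borel_measurable_euclidean_space) (auto simp: Basis_vec_def inner_axis)

lemma borel_measurable_matrix_nth:
  fixes h :: "'a \<Rightarrow> real^'n^'m"
  assumes "h \<in> borel_measurable F"
  shows "(\<lambda>s. h s $ i $ j) \<in> borel_measurable F"
  by (rule borel_measurable_continuous_on[OF _ assms, where f = "\<lambda>A. A $ i $ j"])
     (intro continuous_intros)

lemma borel_measurable_det:
  fixes h :: "'a \<Rightarrow> real^'n^'n"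
  assumes "\<And>i j. (\<lambda>s. h s $ i $ j) \<in> borel_measurable F"
  shows "(\<lambda>s. det (h s)) \<in> borel_measurable F"
  unfolding det_def using assms by (intro borel_measurable_sum borel_measurable_times
      borel_measurable_prod borel_measurable_const)

lemma borel_measurable_matrix_vector_mult:
  fixes A :: "'a \<Rightarrow> real^'n^'m"
  assumes "A \<in> borel_measurable F" and "b \<in> borel_measurable F"
  shows "(\<lambda>s. A s *v b s) \<in> borel_measurable F"
  unfolding borel_measurable_vec_iff matrix_vector_mult_def
  using borel_measurable_matrix_nth[OF assms(1)] assms(2)[unfolded borel_measurable_vec_iff]
  by (auto intro!: borel_measurable_sum borel_measurable_times)

text \<open>Each component is a quotient of determinants, which are polynomials in the data; the
  totalized real division is Borel measurable also where the denominator vanishes.\<close>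

lemma borel_measurable_kkt_solution:
  assumes "H \<in> borel_measurable F" and "J \<in> borel_measurable F" and "b \<in> borel_measurable F"
  shows "(\<lambda>s. kkt_solution (H s) (J s) (b s)) \<in> borel_measurable F"
proof -
  have b: "(\<lambda>s. b s $ i) \<in> borel_measurable F" for i
    using assms(3) by (simp add: borel_measurable_vec_iff)
  have rhs: "(\<lambda>s. kkt_vector (- b s) 0 $ i) \<in> borel_measurable F" for i
    by (cases i) (auto simp: kkt_vector_def intro!: borel_measurable_uminus b)
  have entry: "(\<lambda>s. kkt_matrix (H s) (J s) $ i $ l) \<in> borel_measurable F" for i l
    by (cases i; cases l) (auto simp: kkt_matrix_def kkt_vector_def transpose_def
        intro!: borel_measurable_matrix_nth assms)
  have "(\<lambda>s. (if l = k then kkt_vector (- b s) 0 $ i else kkt_matrix (H s) (J s) $ i $ l))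
      \<in> borel_measurable F" for i l k
    by (cases "l = k") (simp_all add: rhs entry)
  then show ?thesis
    unfolding borel_measurable_vec_iff kkt_solution_def
    by (auto intro!: borel_measurable_divide borel_measurable_det entry)
qed

section \<open>Decrease of the merit function\<close>

text \<open>Subtracting the quadratic \<open>t * h' 0 + C * t\<^sup>2 / 2\<close> from
  \<open>h\<close> leaves a function with nonpositive derivative on the unit interval; its values at
  0 and 1 are compared.\<close>

lemma quadratic_upper_bound_of_derivative:
  fixes h h' :: "real \<Rightarrow> real"
  assumes "\<And>t. 0 \<le> t \<Longrightarrow> t \<le> 1 \<Longrightarrow> (h has_real_derivative h' t) (at t)"
    and "\<And>t. 0 \<le> t \<Longrightarrow> t \<le> 1 \<Longrightarrow> h' t - h' 0 \<le> C * t"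
  shows "h 1 \<le> h 0 + h' 0 + C / 2"
proof -
  define q where "q t = h t - t * h' 0 - C * t\<^sup>2 / 2" for t
  have "(q has_real_derivative (h' t - h' 0 - C * t)) (at t)" if "0 \<le> t" "t \<le> 1" for t
    unfolding q_def using assms(1)[OF that]
    by (auto intro!: derivative_eq_intros)
  then have "q 1 \<le> q 0"
    by (intro DERIV_nonpos_imp_nonincreasing[of 0 1 q]) (use assms(2) in force)+
  then show ?thesis by (simp add: q_def)
qed

lemma convex_segment_mem:
  fixes x p :: "'a::real_vector"
  assumes "convex X" and "x \<in> X" and "x + p \<in> X" and "0 \<le> t" and "t \<le> 1"
  shows "x + t *\<^sub>R p \<in> X"
proof -
  have "(1 - t) *\<^sub>R x + t *\<^sub>R (x + p) \<in> X"
    using assms by (intro convexD_alt) auto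
  then show ?thesis by (simp add: algebra_simps)
qed

text \<open>Along the segment the directional derivative grows by at most
  \<open>L * (norm p)\<^sup>2 * t\<close>, so the scalar estimate applies; this is the classical
  descent lemma.\<close>

lemma lipschitz_gradient_upper_bound:
  fixes f :: "'a::real_inner \<Rightarrow> real"
  assumes "convex X" and "\<And>y. y \<in> X \<Longrightarrow> GDERIV f y :> gf y" and "L-lipschitz_on X gf"
    and "x \<in> X" and "x + p \<in> X"
  shows "f (x + p) \<le> f x + gf x \<bullet> p + L / 2 * (norm p)\<^sup>2"
proof -
  note seg = convex_segment_mem[OF assms(1,4,5)]
  define h where "h t = f (x + t *\<^sub>R p)" for t
  define h' where "h' t = gf (x + t *\<^sub>R p) \<bullet> p" for t
  have "h 1 \<le> h 0 + h' 0 + (L * (norm p)\<^sup>2) / 2"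
  proof (rule quadratic_upper_bound_of_derivative)
    fix t :: real assume t: "0 \<le> t" "t \<le> 1"
    have "(f has_derivative (\<lambda>z. z \<bullet> gf (x + t *\<^sub>R p))) (at (x + t *\<^sub>R p))"
      using assms(2)[OF seg[OF t]] by (simp add: gderiv_def inner_commute)
    then have "((\<lambda>t. f (x + t *\<^sub>R p)) has_derivative (\<lambda>s. (s *\<^sub>R p) \<bullet> gf (x + t *\<^sub>R p))) (at t)"
      by (rule has_derivative_compose[rotated]) (auto intro!: derivative_eq_intros)
    then show "(h has_real_derivative h' t) (at t)"
      unfolding h_def h'_def has_field_derivative_def
      by (rule has_derivative_eq_rhs) (auto simp: inner_commute mult.commute)
    have "h' t - h' 0 = (gf (x + t *\<^sub>R p) - gf x) \<bullet> p"
      by (simp add: h'_def inner_diff_left)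
    also have "\<dots> \<le> norm (gf (x + t *\<^sub>R p) - gf x) * norm p"
      by (rule norm_cauchy_schwarz)
    also have "norm (gf (x + t *\<^sub>R p) - gf x) \<le> L * (t * norm p)"
      using lipschitz_onD[OF assms(3) seg[OF t] assms(4)] t by (simp add: dist_norm)
    finally show "h' t - h' 0 \<le> L * (norm p)\<^sup>2 * t"
      by (simp add: mult_right_mono power2_eq_square mult_ac)
  qed
  then show ?thesis by (simp add: h_def h'_def)
qed

text \<open>The scalar estimate is applied to \<open>y \<bullet> c\<close>, with \<open>y\<close> the linearization error itself.\<close>

lemma lipschitz_jacobian_linearization_error:
  fixes c :: "real^'n \<Rightarrow> real^'m"
  assumes "convex X" and "\<And>y. y \<in> X \<Longrightarrow> (c has_derivative (*v) (J y)) (at y)"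
    and "\<And>y z. y \<in> X \<Longrightarrow> z \<in> X \<Longrightarrow> induced_norm (J y - J z) \<le> \<Gamma> * norm (y - z)"
    and "x \<in> X" and "x + p \<in> X"
  shows "norm (c (x + p) - c x - J x *v p) \<le> \<Gamma> / 2 * (norm p)\<^sup>2"
proof -
  note seg = convex_segment_mem[OF assms(1,4,5)]
  define y where "y = c (x + p) - c x - J x *v p"
  define h where "h t = y \<bullet> c (x + t *\<^sub>R p)" for t
  define h' where "h' t = y \<bullet> (J (x + t *\<^sub>R p) *v p)" for t
  have "h 1 \<le> h 0 + h' 0 + (norm y * (\<Gamma> * (norm p)\<^sup>2)) / 2"
  proof (rule quadratic_upper_bound_of_derivative)
    fix t :: real assume t: "0 \<le> t" "t \<le> 1"
    have "((\<lambda>t. c (x + t *\<^sub>R p)) has_derivative (\<lambda>s. J (x + t *\<^sub>R p) *v (s *\<^sub>R p))) (at t)"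
      using assms(2)[OF seg[OF t]]
      by (rule has_derivative_compose[rotated]) (auto intro!: derivative_eq_intros)
    from has_derivative_inner_right[OF this, of y]
    show "(h has_real_derivative h' t) (at t)"
      unfolding h_def h'_def has_field_derivative_def
      by (rule has_derivative_eq_rhs) (auto simp: matrix_vector_mult_scaleR mult.commute)
    have "h' t - h' 0 = y \<bullet> ((J (x + t *\<^sub>R p) - J x) *v p)"
      by (simp add: h'_def inner_diff_right matrix_vector_mult_diff_rdistrib)
    also have "\<dots> \<le> norm y * norm ((J (x + t *\<^sub>R p) - J x) *v p)"
      by (rule norm_cauchy_schwarz)
    also have "norm ((J (x + t *\<^sub>R p) - J x) *v p) \<le> (\<Gamma> * (t * norm p)) * norm p"
      using norm_matrix_vector_le_induced_norm[of "J (x + t *\<^sub>R p) - J x" p]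
        mult_right_mono[OF assms(3)[OF seg[OF t] assms(4)], of "norm p"] t
      by simp
    finally have "h' t - h' 0 \<le> norm y * (\<Gamma> * (t * norm p) * norm p)"
      by (simp add: mult_left_mono)
    then show "h' t - h' 0 \<le> norm y * (\<Gamma> * (norm p)\<^sup>2) * t"
      by (simp add: power2_eq_square mult_ac)
  qed
  \<comment> \<open>The choice of \<open>y\<close> turns the scalar remainder into
    \<open>(norm y)\<^sup>2\<close>, while the bound on it carries one factor \<open>norm y\<close>,
    which cancels.\<close>
  moreover have "y \<bullet> y = h 1 - h 0 - h' 0"
    by (subst (2) y_def) (simp add: h_def h'_def inner_diff_right)
  ultimately have "norm y * norm y \<le> norm y * (\<Gamma> / 2 * (norm p)\<^sup>2)"
    by (simp add: dot_square_norm power2_eq_square[of "norm y"])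
  \<comment> \<open>This settles the case \<open>y = 0\<close>; the sign of \<Gamma> is read off
    from the Lipschitz bound at the two endpoints.\<close>
  moreover have "0 \<le> \<Gamma> / 2 * (norm p)\<^sup>2"
  proof (cases "p = 0")
    case False
    have "0 \<le> \<Gamma> * norm (x + p - x)"
      using assms(3)[OF assms(5,4)] induced_norm_nonneg order_trans by blast
    with False show ?thesis by (simp add: zero_le_mult_iff)
  qed simp
  ultimately show ?thesis unfolding y_def[symmetric]
    by (cases "y = 0") auto
qed

text \<open>The tangential part does not change the linearized constraint, which therefore equals a
  convex combination of \<open>c x\<close> and \<open>c x + J x *v v\<close>; this is where
  \<open>\<alpha> \<le> 1\<close> enters. The Taylor errors of \<open>f\<close> and \<open>c\<close>
  add up to the last term.\<close>

lemma merit_upper_bound: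
  fixes c :: "real^'n \<Rightarrow> real^'m"
  assumes "smoothness_assumption X f gf c J L \<Gamma>" and "x \<in> X" and "x + \<alpha> *\<^sub>R d \<in> X"
    and "J x *v d = J x *v v" and "0 \<le> \<alpha>" and "\<alpha> \<le> 1" and "0 \<le> \<tau>"
  shows "\<tau> * f (x + \<alpha> *\<^sub>R d) + norm (c (x + \<alpha> *\<^sub>R d))
    \<le> \<tau> * f x + norm (c x)
      - \<alpha> * (norm (c x) - norm (c x + J x *v v) - \<tau> * (gf x \<bullet> d))
      + 1/2 * (\<tau> * L + \<Gamma>) * (\<alpha>\<^sup>2 * (norm d)\<^sup>2)"
proof -
  note sm = assms(1)[unfolded smoothness_assumption_def]
  have f: "f (x + \<alpha> *\<^sub>R d) \<le> f x + \<alpha> * (gf x \<bullet> d) + L / 2 * (\<alpha>\<^sup>2 * (norm d)\<^sup>2)"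
    using lipschitz_gradient_upper_bound[of X f gf L x "\<alpha> *\<^sub>R d"] sm assms(2,3)
    by (simp add: power_mult_distrib)
  have "norm (c (x + \<alpha> *\<^sub>R d) - c x - J x *v (\<alpha> *\<^sub>R d)) \<le> \<Gamma> / 2 * (norm (\<alpha> *\<^sub>R d))\<^sup>2"
    using sm assms(2,3) by (intro lipschitz_jacobian_linearization_error[of X]) auto
  then have e: "norm (c (x + \<alpha> *\<^sub>R d) - (c x + \<alpha> *\<^sub>R (J x *v v))) \<le> \<Gamma> / 2 * (\<alpha>\<^sup>2 * (norm d)\<^sup>2)"
    by (simp add: matrix_vector_mult_scaleR assms(4) power_mult_distrib algebra_simps)
  have "c x + \<alpha> *\<^sub>R (J x *v v) = (1 - \<alpha>) *\<^sub>R c x + \<alpha> *\<^sub>R (c x + J x *v v)"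
    by (simp add: algebra_simps)
  then have "norm (c x + \<alpha> *\<^sub>R (J x *v v)) \<le> (1 - \<alpha>) * norm (c x) + \<alpha> * norm (c x + J x *v v)"
    using assms(5,6) norm_triangle_ineq[of "(1 - \<alpha>) *\<^sub>R c x" "\<alpha> *\<^sub>R (c x + J x *v v)"] by simp
  with e have "norm (c (x + \<alpha> *\<^sub>R d)) \<le> (1 - \<alpha>) * norm (c x) + \<alpha> * norm (c x + J x *v v)
      + \<Gamma> / 2 * (\<alpha>\<^sup>2 * (norm d)\<^sup>2)"
    using norm_triangle_sub[of "c (x + \<alpha> *\<^sub>R d)" "c x + \<alpha> *\<^sub>R (J x *v v)"] by linarith
  moreover have "\<tau> * f (x + \<alpha> *\<^sub>R d) \<le> \<tau> * (f x + \<alpha> * (gf x \<bullet> d) + L / 2 * (\<alpha>\<^sup>2 * (norm d)\<^sup>2))"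
    using f assms(7) by (rule mult_left_mono)
  ultimately show ?thesis by (simp add: field_simps)
qed

text \<open>The hypotheses chain to \<open>norm c * (\<kappa>\<^sub>v * \<sigma>\<^sub>J * j) \<le>
  norm c * R\<close>, and cancelling \<open>norm c\<close> makes \<open>R\<close> dominate a
  multiple of \<open>j\<close>, hence also of \<open>norm c\<close>. If \<open>c = 0\<close>, the
  bound on \<open>norm v\<close> forces \<open>v = 0\<close> and thus \<open>R = 0\<close>.\<close>

lemma linearized_feasibility_reduction:
  fixes J :: "real^'n^'m" and c :: "real^'m" and v :: "real^'n"
  defines "R \<equiv> norm c - norm (c + J *v v)" and "j \<equiv> norm (transpose J *v c)"
  assumes "\<kappa>\<^sub>v * j\<^sup>2 \<le> norm c * R" and "\<sigma>\<^sub>J * norm c \<le> j" and "norm v \<le> \<omega> * j"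
    and "norm c \<le> \<kappa>\<^sub>c" and "0 < \<kappa>\<^sub>v" and "0 < \<sigma>\<^sub>J"
  shows "0 \<le> R" and "\<kappa>\<^sub>v * \<sigma>\<^sub>J * j \<le> R" and "\<kappa>\<^sub>v * \<sigma>\<^sub>J\<^sup>2 * norm c \<le> R" and "\<kappa>\<^sub>v * j\<^sup>2 \<le> \<kappa>\<^sub>c * R"
proof -
  have "0 \<le> j" by (simp add: j_def)
  show a: "\<kappa>\<^sub>v * \<sigma>\<^sub>J * j \<le> R"
  proof (cases "c = 0")
    case True
    then have "j = 0" by (simp add: j_def)
    with True assms(5) show ?thesis by (simp add: R_def)
  next
    case False
    have "\<kappa>\<^sub>v * (\<sigma>\<^sub>J * norm c * j) \<le> \<kappa>\<^sub>v * (j * j)"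
      using assms(4,7) \<open>0 \<le> j\<close> by (intro mult_left_mono mult_right_mono) auto
    with assms(3) have "norm c * (\<kappa>\<^sub>v * \<sigma>\<^sub>J * j) \<le> norm c * R"
      by (simp add: power2_eq_square mult_ac)
    with False show ?thesis by simp
  qed
  have "\<kappa>\<^sub>v * \<sigma>\<^sub>J * (\<sigma>\<^sub>J * norm c) \<le> \<kappa>\<^sub>v * \<sigma>\<^sub>J * j"
    using assms(4,7,8) by (intro mult_left_mono) auto
  with a show "\<kappa>\<^sub>v * \<sigma>\<^sub>J\<^sup>2 * norm c \<le> R" by (simp add: power2_eq_square mult_ac)
  show "0 \<le> R" using a assms(7,8) \<open>0 \<le> j\<close>
    by (meson less_imp_le mult_nonneg_nonneg order_trans)
  with assms(3,6) show "\<kappa>\<^sub>v * j\<^sup>2 \<le> \<kappa>\<^sub>c * R"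
    by (meson mult_right_mono order_trans)
qed

text \<open>The choice of \<open>\<tau>\<close> makes the loss along \<open>v\<close> at most the fraction \<open>1 - \<sigma>\<close> of \<open>R\<close>.\<close>

lemma model_reduction_lower_bound:
  fixes H :: "real^'n^'n" and J :: "real^'n^'m"
  assumes "stationary H J (b + H *v v) u" and "transpose H = H" and "induced_norm H \<le> \<kappa>\<^sub>H"
    and "norm b \<le> \<kappa>\<^sub>g" and "norm u \<le> \<kappa>\<^sub>u" and "norm v \<le> \<omega> * j" and "\<kappa>\<^sub>v * \<sigma>\<^sub>J * j \<le> R"
    and "0 \<le> \<beta>" and "\<beta> \<le> \<kappa>\<^sub>\<beta>" and "0 \<le> \<tau>" and "\<sigma> \<le> 1"
    and "\<tau> * (\<omega> * (\<kappa>\<^sub>\<beta> * \<kappa>\<^sub>H * \<kappa>\<^sub>u + \<kappa>\<^sub>g)) = (1 - \<sigma>) * \<kappa>\<^sub>v * \<sigma>\<^sub>J"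
  shows "\<tau> * \<beta> * (u \<bullet> (H *v u)) + \<sigma> * R \<le> R - \<tau> * (b \<bullet> (\<beta> *\<^sub>R u + v))"
proof -
  have H: "0 \<le> \<kappa>\<^sub>H" using assms(3) induced_norm_nonneg order_trans by blast
  have u: "0 \<le> \<kappa>\<^sub>u" using assms(5) norm_ge_zero order_trans by blast
  \<comment> \<open>Stationarity trades the slope along \<open>u\<close> for curvature, up to a
    cross term with \<open>H *v v\<close> that is charged to \<open>norm v\<close> below.\<close>
  have bu: "b \<bullet> u = - (u \<bullet> (H *v u)) - (H *v v) \<bullet> u"
    using stationary_inner_self[OF assms(1)] by (simp add: inner_left_distrib)
  have "norm (H *v v) \<le> \<kappa>\<^sub>H * norm v"
    using norm_matrix_vector_le_induced_norm[of H v] mult_right_mono[OF assms(3), of "norm v"]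
    by simp
  then have "norm (H *v v) * norm u \<le> \<kappa>\<^sub>H * norm v * \<kappa>\<^sub>u"
    using assms(5) H by (intro mult_mono) auto
  then have "\<bar>(H *v v) \<bullet> u\<bar> \<le> \<kappa>\<^sub>H * norm v * \<kappa>\<^sub>u"
    using Cauchy_Schwarz_ineq2[of "H *v v" u] by linarith
  then have "\<beta> * \<bar>(H *v v) \<bullet> u\<bar> \<le> \<kappa>\<^sub>\<beta> * (\<kappa>\<^sub>H * norm v * \<kappa>\<^sub>u)"
    using assms(8,9) by (intro mult_mono) auto
  then have 1: "- (\<beta> * ((H *v v) \<bullet> u)) \<le> \<kappa>\<^sub>\<beta> * (\<kappa>\<^sub>H * norm v * \<kappa>\<^sub>u)"
    using assms(8) by (smt (verit) mult_minus_right mult_left_mono)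
  have 2: "b \<bullet> v \<le> \<kappa>\<^sub>g * norm v"
    using norm_cauchy_schwarz[of b v] mult_right_mono[OF assms(4), of "norm v"] by simp
  have "b \<bullet> (\<beta> *\<^sub>R u + v) = - (\<beta> * (u \<bullet> (H *v u))) - \<beta> * ((H *v v) \<bullet> u) + b \<bullet> v"
    by (simp add: inner_right_distrib bu algebra_simps)
  also have "\<dots> \<le> - (\<beta> * (u \<bullet> (H *v u))) + (\<kappa>\<^sub>\<beta> * \<kappa>\<^sub>H * \<kappa>\<^sub>u + \<kappa>\<^sub>g) * norm v"
    using 1 2 by (simp add: algebra_simps)
  also have "(\<kappa>\<^sub>\<beta> * \<kappa>\<^sub>H * \<kappa>\<^sub>u + \<kappa>\<^sub>g) * norm v \<le> (\<kappa>\<^sub>\<beta> * \<kappa>\<^sub>H * \<kappa>\<^sub>u + \<kappa>\<^sub>g) * (\<omega> * j)"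
  proof (rule mult_left_mono[OF assms(6)])
    have "0 \<le> \<kappa>\<^sub>\<beta>" "0 \<le> \<kappa>\<^sub>g"
      using assms(8,9) order_trans[OF norm_ge_zero assms(4)] by auto
    with H u show "0 \<le> \<kappa>\<^sub>\<beta> * \<kappa>\<^sub>H * \<kappa>\<^sub>u + \<kappa>\<^sub>g" by simp
  qed
  finally have "\<tau> * (b \<bullet> (\<beta> *\<^sub>R u + v))
      \<le> \<tau> * (- (\<beta> * (u \<bullet> (H *v u))) + (\<kappa>\<^sub>\<beta> * \<kappa>\<^sub>H * \<kappa>\<^sub>u + \<kappa>\<^sub>g) * (\<omega> * j))"
    using assms(10) by (simp add: mult_left_mono)
  also have "\<dots> = - (\<tau> * \<beta> * (u \<bullet> (H *v u))) + \<tau> * (\<omega> * (\<kappa>\<^sub>\<beta> * \<kappa>\<^sub>H * \<kappa>\<^sub>u + \<kappa>\<^sub>g)) * j"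
    by (simp add: algebra_simps)
  also have "\<dots> = - (\<tau> * \<beta> * (u \<bullet> (H *v u))) + (1 - \<sigma>) * (\<kappa>\<^sub>v * \<sigma>\<^sub>J * j)"
    by (simp add: assms(12))
  also have "\<dots> \<le> - (\<tau> * \<beta> * (u \<bullet> (H *v u))) + (1 - \<sigma>) * R"
    using assms(7,11) by (simp add: mult_left_mono)
  finally show ?thesis by (simp add: algebra_simps)
qed

text \<open>The square root lies below its tangent at \<open>M\<close>, evaluated at
  \<open>z\<^sup>2\<close>. The norm of the noise is thereby bounded outcome by outcome by an affine
  function of its square, which the variance bound controls in expectation.\<close>

lemma real_le_sqrt_affine_square:
  fixes z M :: real
  assumes "0 < M"
  shows "z \<le> sqrt M + (z\<^sup>2 - M) / (2 * sqrt M)"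
proof -
  have "0 \<le> (z - sqrt M)\<^sup>2" by simp
  then have "2 * sqrt M * z \<le> z\<^sup>2 + M"
    using assms by (simp add: power2_diff mult_ac)
  then have "z \<le> (z\<^sup>2 + M) / (2 * sqrt M)"
    using assms by (simp add: field_simps)
  also have "\<dots> = sqrt M + (z\<^sup>2 - M) / (2 * sqrt M)"
    using assms by (simp add: field_simps)
  finally show ?thesis .
qed

text \<open>The noise enters only through a term of conditional mean zero, \<open>w \<bullet> e\<close>, and through
  \<open>(norm e)\<^sup>2 - M\<close>, whose conditional mean is nonpositive.\<close>

lemma merit_one_step:
  fixes c :: "real^'n \<Rightarrow> real^'m" and J :: "real^'n \<Rightarrow> real^'n^'m"
    and \<tau> L \<Gamma> :: real
  defines "T \<equiv> \<tau> * L + \<Gamma>"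
  assumes sm: "smoothness_assumption X f gf c J L \<Gamma>" and x: "x \<in> X" "x + \<alpha> *\<^sub>R d \<in> X"
    and d: "d = \<beta> *\<^sub>R u + v"
    and H: "transpose H = H" "induced_norm H \<le> \<kappa>\<^sub>H" "0 < \<zeta>"
      "\<And>u. J x *v u = 0 \<Longrightarrow> \<zeta> * (norm u)\<^sup>2 \<le> u \<bullet> (H *v u)"
    and u: "stationary H (J x) (gf x + e + H *v v) u"
    and ut: "stationary H (J x) (gf x + H *v v) ut"
    and w: "stationary H (J x) ((\<nu> * \<tau> * \<beta>) *\<^sub>R gf x + (T * \<beta>\<^sup>2) *\<^sub>R ut) w"
    and v: "v \<in> range ((*v) (transpose (J x)))" "norm v \<le> \<omega> * norm (transpose (J x) *v c x)"
    and bounds: "norm (gf x) \<le> \<kappa>\<^sub>g" "norm (c x) \<le> \<kappa>\<^sub>c" "induced_norm (J x) \<le> \<kappa>\<^sub>J" "norm ut \<le> \<kappa>\<^sub>u"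
    and red: "\<kappa>\<^sub>v * (norm (transpose (J x) *v c x))\<^sup>2
        \<le> norm (c x) * (norm (c x) - norm (c x + J x *v v))"
    and licq: "\<sigma>\<^sub>J * norm (c x) \<le> norm (transpose (J x) *v c x)"
    and pos: "0 < \<kappa>\<^sub>v" "0 < \<sigma>\<^sub>J" "0 < \<kappa>\<^sub>c" "0 < \<sigma>" "\<sigma> < 1" "0 < \<tau>" "0 < \<beta>" "0 < \<nu>" "0 < \<theta>" "0 < M"
      "0 < \<omega>"
    and \<beta>: "\<beta> \<le> \<kappa>\<^sub>\<beta>"
    and \<tau>: "\<tau> * (\<omega> * (\<kappa>\<^sub>\<beta> * \<kappa>\<^sub>H * \<kappa>\<^sub>u + \<kappa>\<^sub>g)) = (1 - \<sigma>) * \<kappa>\<^sub>v * \<sigma>\<^sub>J"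
    and \<nu>: "\<nu> * (2 * T * \<omega>\<^sup>2) \<le> \<sigma> * \<kappa>\<^sub>v / \<kappa>\<^sub>c" "\<nu> + \<theta> * \<beta> \<le> 1"
    and \<alpha>: "\<nu> \<le> \<alpha>" "\<alpha> \<le> \<nu> + \<theta> * \<beta>"
  shows "\<tau> * f (x + \<alpha> *\<^sub>R d) + norm (c (x + \<alpha> *\<^sub>R d))
    \<le> \<tau> * f x + norm (c x)
      - \<nu> * (\<tau> * \<beta> * (ut \<bullet> (H *v ut)) + 1/2 * \<sigma> * \<kappa>\<^sub>v * \<sigma>\<^sub>J\<^sup>2 * norm (c x))
      + \<beta>\<^sup>2 * (1/2 * T * (1 / \<zeta> * \<kappa>\<^sub>H * \<kappa>\<^sub>u\<^sup>2 + 1 / \<zeta>\<^sup>2 * M)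
          + \<theta> * \<kappa>\<^sub>g * \<tau> * (1 / \<zeta>) * sqrt M + \<theta>\<^sup>2 * T * \<omega>\<^sup>2 * \<kappa>\<^sub>J\<^sup>2 * \<kappa>\<^sub>c\<^sup>2)
      + \<beta>\<^sup>2 * (1/2 * T / \<zeta>\<^sup>2 + \<theta> * \<kappa>\<^sub>g * \<tau> / \<zeta> / (2 * sqrt M)) * ((norm e)\<^sup>2 - M)
      + w \<bullet> e"
proof -
  define R where "R = norm (c x) - norm (c x + J x *v v)"
  define j where "j = norm (transpose (J x) *v c x)"
  define A where "A = ut \<bullet> (H *v ut)"
  define r where "r = u - ut"
  have T: "0 < T" using sm pos(6) by (simp add: T_def smoothness_assumption_def add_pos_pos)
  have \<kappa>: "0 \<le> \<kappa>\<^sub>H" "0 \<le> \<kappa>\<^sub>g" "0 \<le> \<kappa>\<^sub>J"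
    using H(2) bounds induced_norm_nonneg norm_ge_zero by (meson order_trans)+
  note R = linearized_feasibility_reduction[OF red licq v(2) bounds(2) pos(1,2), folded R_def j_def]
  have \<Delta>: "\<tau> * \<beta> * A + \<sigma> * R \<le> R - \<tau> * (gf x \<bullet> (\<beta> *\<^sub>R ut + v))"
    unfolding A_def
    by (rule model_reduction_lower_bound[OF ut H(1,2) bounds(1,4) v(2)[folded j_def] R(2) _ \<beta> _ _ \<tau>])
       (use pos in auto)
  have J: "J x *v u = 0" "J x *v ut = 0"
    using u ut by (auto simp: stationary_def)
  have A: "0 \<le> A" using H(3) H(4)[OF J(2)] unfolding A_def
    by (meson order_trans less_imp_le mult_nonneg_nonneg zero_le_power2)
  have rst: "stationary H (J x) e r"
    using stationary_diff[OF u ut] by (simp add: r_def)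
  have rn: "norm r \<le> norm e / \<zeta>"
    using rst H(3,4) by (intro stationary_norm_le[of H "J x"]) (auto simp: stationary_def)
  \<comment> \<open>The left-hand side collects the terms linear in \<open>r\<close> from the
    first-order and the second-order estimate below. Self-adjointness of the solution operator moves
    them from \<open>r\<close> onto the noise itself.\<close>
  have we: "\<nu> * \<tau> * \<beta> * (gf x \<bullet> r) + T * \<beta>\<^sup>2 * (ut \<bullet> r) = w \<bullet> e"
    using stationary_swap[OF rst w H(1)] by (simp add: inner_left_distrib)
  have orth: "u \<bullet> v = 0"
    using v(1) J(1) by (auto simp: inner_commute[of u] simp flip: inner_matrix_vector_transpose)
  have dn: "(norm d)\<^sup>2 = \<beta>\<^sup>2 * (norm u)\<^sup>2 + (norm v)\<^sup>2"
    using orth by (simp add: d norm_add_Pythagorean orthogonal_def power_mult_distrib)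
  have un: "(norm u)\<^sup>2 = (norm ut)\<^sup>2 + 2 * (ut \<bullet> r) + (norm r)\<^sup>2"
    using dot_norm[of ut r] by (simp add: r_def)
  have \<alpha>01: "0 \<le> \<alpha>" "\<alpha> \<le> 1" using \<alpha> \<nu>(2) pos by linarith+

  have step: "\<tau> * f (x + \<alpha> *\<^sub>R d) + norm (c (x + \<alpha> *\<^sub>R d)) \<le> \<tau> * f x + norm (c x)
      - \<alpha> * (R - \<tau> * (gf x \<bullet> d)) + 1/2 * T * (\<alpha>\<^sup>2 * (norm d)\<^sup>2)"
    unfolding R_def T_def using J(1) \<alpha>01 pos(6)
    by (intro merit_upper_bound[OF sm x])
       (auto simp: d matrix_vector_right_distrib matrix_vector_mult_scaleR)

  \<comment> \<open>The stepsize may be correlated with the noise, so only its fixed part \<nu> may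
    multiply the mean-zero term. The excess \<open>\<alpha> - \<nu>\<close> is at most
    \<open>\<theta> * \<beta>\<close> and costs a term of order
    \<open>\<beta>\<^sup>2 * norm e\<close>.\<close>
  have lin: "- \<alpha> * (R - \<tau> * (gf x \<bullet> d)) \<le> - \<nu> * (\<tau> * \<beta> * A + \<sigma> * R)
      + \<nu> * \<tau> * \<beta> * (gf x \<bullet> r) + \<beta>\<^sup>2 * (\<theta> * \<kappa>\<^sub>g * \<tau> / \<zeta>) * norm e"
  proof -
    have "gf x \<bullet> d = gf x \<bullet> (\<beta> *\<^sub>R ut + v) + \<beta> * (gf x \<bullet> r)"
      by (simp add: d r_def inner_right_distrib inner_diff_right algebra_simps)
    then have "- \<alpha> * (R - \<tau> * (gf x \<bullet> d))
        = - \<alpha> * (R - \<tau> * (gf x \<bullet> (\<beta> *\<^sub>R ut + v))) + \<alpha> * \<tau> * \<beta> * (gf x \<bullet> r)"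
      by (simp add: algebra_simps)
    moreover have "\<nu> * (\<tau> * \<beta> * A + \<sigma> * R) \<le> \<alpha> * (R - \<tau> * (gf x \<bullet> (\<beta> *\<^sub>R ut + v)))"
      using \<Delta> \<alpha>(1) A R(1) pos by (intro mult_mono) auto
    moreover have "(\<alpha> - \<nu>) * (\<tau> * \<beta> * (gf x \<bullet> r)) \<le> (\<theta> * \<beta>) * (\<tau> * \<beta> * (\<kappa>\<^sub>g * (norm e / \<zeta>)))"
    proof -
      have "gf x \<bullet> r \<le> norm (gf x) * norm r" by (rule norm_cauchy_schwarz)
      also have "\<dots> \<le> \<kappa>\<^sub>g * (norm e / \<zeta>)"
        using bounds(1) rn \<kappa> by (intro mult_mono) auto
      finally have "gf x \<bullet> r \<le> \<kappa>\<^sub>g * (norm e / \<zeta>)" .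
      then have "(\<alpha> - \<nu>) * (\<tau> * \<beta> * (gf x \<bullet> r)) \<le> (\<alpha> - \<nu>) * (\<tau> * \<beta> * (\<kappa>\<^sub>g * (norm e / \<zeta>)))"
        using \<alpha>(1) pos by (intro mult_left_mono) auto
      also have "\<dots> \<le> (\<theta> * \<beta>) * (\<tau> * \<beta> * (\<kappa>\<^sub>g * (norm e / \<zeta>)))"
        using \<alpha>(2) pos \<kappa> H(3) by (intro mult_right_mono) auto
      finally show ?thesis .
    qed
    ultimately show ?thesis by (simp add: algebra_simps power2_eq_square)
  qed

  have quad: "1/2 * T * (\<alpha>\<^sup>2 * (norm d)\<^sup>2) \<le> \<beta>\<^sup>2 * (1/2 * T * (1 / \<zeta> * \<kappa>\<^sub>H * \<kappa>\<^sub>u\<^sup>2))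
      + T * \<beta>\<^sup>2 * (ut \<bullet> r) + \<beta>\<^sup>2 * (1/2 * T / \<zeta>\<^sup>2) * (norm e)\<^sup>2
      + \<nu> * (1/2 * \<sigma> * R) + \<beta>\<^sup>2 * (\<theta>\<^sup>2 * T * \<omega>\<^sup>2 * \<kappa>\<^sub>J\<^sup>2 * \<kappa>\<^sub>c\<^sup>2)"
  proof -
    \<comment> \<open>If \<open>ut\<close> is nonzero, its curvature lies between
      \<open>\<zeta> * (norm ut)\<^sup>2\<close> and
      \<open>\<kappa>\<^sub>H * (norm ut)\<^sup>2\<close>, so the extra factor
      \<open>\<kappa>\<^sub>H / \<zeta>\<close> is at least 1.\<close>
    have utn: "(norm ut)\<^sup>2 \<le> 1 / \<zeta> * \<kappa>\<^sub>H * \<kappa>\<^sub>u\<^sup>2"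
    proof (cases "ut = 0")
      case True
      with \<kappa> H(3) show ?thesis by simp
    next
      case False
      have "\<zeta> * (norm ut)\<^sup>2 \<le> norm ut * norm (H *v ut)"
        using H(4)[OF J(2)] norm_cauchy_schwarz[of ut "H *v ut"] by linarith
      also have "\<dots> \<le> norm ut * (\<kappa>\<^sub>H * norm ut)"
        using norm_matrix_vector_le_induced_norm[of H ut] mult_right_mono[OF H(2), of "norm ut"]
        by (intro mult_left_mono) auto
      finally have "\<zeta> \<le> \<kappa>\<^sub>H"
        using False by (simp add: power2_eq_square mult_ac)
      have "(norm ut)\<^sup>2 \<le> 1 * \<kappa>\<^sub>u\<^sup>2"
        using bounds(4) by (simp add: power_mono)
      also have "\<dots> \<le> (\<kappa>\<^sub>H / \<zeta>) * \<kappa>\<^sub>u\<^sup>2"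
        using \<open>\<zeta> \<le> \<kappa>\<^sub>H\<close> H(3) by (intro mult_right_mono) auto
      finally show ?thesis by simp
    qed
    have "(norm r)\<^sup>2 \<le> (norm e / \<zeta>)\<^sup>2" using rn by (intro power_mono) auto
    then have un': "(norm u)\<^sup>2 \<le> 1 / \<zeta> * \<kappa>\<^sub>H * \<kappa>\<^sub>u\<^sup>2 + 2 * (ut \<bullet> r) + (norm e)\<^sup>2 / \<zeta>\<^sup>2"
      using un utn by (simp add: power_divide)
    \<comment> \<open>The stepsize is replaced by 1 before the square is expanded: the cross term
      \<open>ut \<bullet> r\<close> has no sign, and afterwards its coefficient does not depend on
      \<alpha>.\<close>
    have "\<alpha>\<^sup>2 * (\<beta>\<^sup>2 * (norm u)\<^sup>2) \<le> 1 * (\<beta>\<^sup>2 * (norm u)\<^sup>2)"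
      using \<alpha>01 by (intro mult_right_mono) (auto simp: power_le_one)
    also have "\<dots> \<le> \<beta>\<^sup>2 * (1 / \<zeta> * \<kappa>\<^sub>H * \<kappa>\<^sub>u\<^sup>2 + 2 * (ut \<bullet> r) + (norm e)\<^sup>2 / \<zeta>\<^sup>2)"
      using un' by (simp add: mult_left_mono)
    finally have 1: "1/2 * T * (\<alpha>\<^sup>2 * (\<beta>\<^sup>2 * (norm u)\<^sup>2))
        \<le> 1/2 * T * (\<beta>\<^sup>2 * (1 / \<zeta> * \<kappa>\<^sub>H * \<kappa>\<^sub>u\<^sup>2 + 2 * (ut \<bullet> r) + (norm e)\<^sup>2 / \<zeta>\<^sup>2))"
      using T by (intro mult_left_mono) auto
    \<comment> \<open>The normal part needs a finer bound than 1: the share of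
      \<open>\<nu>\<^sup>2\<close> is absorbed by half of \<open>\<sigma> * R\<close> through the
      upper bound on \<nu>, and the rest is of order \<open>\<beta>\<^sup>2\<close>.\<close>
    have "\<alpha>\<^sup>2 \<le> (\<nu> + \<theta> * \<beta>)\<^sup>2" using \<alpha> \<alpha>01 by (intro power_mono)
    also have "\<dots> \<le> 2 * \<nu>\<^sup>2 + 2 * (\<theta> * \<beta>)\<^sup>2"
      using zero_le_power2[of "\<nu> - \<theta> * \<beta>"] unfolding power2_sum power2_diff by linarith
    finally have a2: "\<alpha>\<^sup>2 \<le> 2 * \<nu>\<^sup>2 + 2 * \<theta>\<^sup>2 * \<beta>\<^sup>2" by (simp add: power_mult_distrib)
    have vn: "(norm v)\<^sup>2 \<le> \<omega>\<^sup>2 * j\<^sup>2"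
      using power_mono[OF v(2), of 2] by (simp add: j_def power_mult_distrib)
    have "j \<le> \<kappa>\<^sub>J * \<kappa>\<^sub>c"
      unfolding j_def by (rule order_trans[OF norm_transpose_matrix_vector_le])
        (use bounds \<kappa> in \<open>auto intro!: mult_mono\<close>)
    then have jn: "j\<^sup>2 \<le> \<kappa>\<^sub>J\<^sup>2 * \<kappa>\<^sub>c\<^sup>2"
      using power_mono[of j "\<kappa>\<^sub>J * \<kappa>\<^sub>c" 2] by (simp add: j_def power_mult_distrib)
    have "1/2 * T * (\<alpha>\<^sup>2 * (norm v)\<^sup>2) \<le> 1/2 * T * ((2 * \<nu>\<^sup>2 + 2 * \<theta>\<^sup>2 * \<beta>\<^sup>2) * (\<omega>\<^sup>2 * j\<^sup>2))"
      using T a2 vn by (intro mult_left_mono mult_mono) auto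
    also have "\<dots> = \<nu> / 2 * (\<nu> * (2 * T * \<omega>\<^sup>2) * j\<^sup>2) + (T * \<theta>\<^sup>2 * \<beta>\<^sup>2 * \<omega>\<^sup>2) * j\<^sup>2"
      by (simp add: field_simps power2_eq_square)
    also have "\<dots> \<le> \<nu> / 2 * (\<sigma> * R) + (T * \<theta>\<^sup>2 * \<beta>\<^sup>2 * \<omega>\<^sup>2) * (\<kappa>\<^sub>J\<^sup>2 * \<kappa>\<^sub>c\<^sup>2)"
    proof (intro add_mono mult_left_mono jn)
      have "\<nu> * (2 * T * \<omega>\<^sup>2) * j\<^sup>2 \<le> \<sigma> * \<kappa>\<^sub>v / \<kappa>\<^sub>c * j\<^sup>2"
        using \<nu>(1) by (rule mult_right_mono) simp
      also have "\<dots> = \<sigma> / \<kappa>\<^sub>c * (\<kappa>\<^sub>v * j\<^sup>2)" by simp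
      also have "\<dots> \<le> \<sigma> / \<kappa>\<^sub>c * (\<kappa>\<^sub>c * R)"
        using R(4) pos by (intro mult_left_mono) auto
      also have "\<dots> = \<sigma> * R" using pos by simp
      finally show "\<nu> * (2 * T * \<omega>\<^sup>2) * j\<^sup>2 \<le> \<sigma> * R" .
    qed (use T pos in auto)
    finally have 2: "1/2 * T * (\<alpha>\<^sup>2 * (norm v)\<^sup>2)
        \<le> \<nu> / 2 * (\<sigma> * R) + (T * \<theta>\<^sup>2 * \<beta>\<^sup>2 * \<omega>\<^sup>2) * (\<kappa>\<^sub>J\<^sup>2 * \<kappa>\<^sub>c\<^sup>2)" .
    show ?thesis
      using 1 2 unfolding dn by (simp add: algebra_simps)
  qed

  have "\<beta>\<^sup>2 * (\<theta> * \<kappa>\<^sub>g * \<tau> / \<zeta>) * norm e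
      \<le> \<beta>\<^sup>2 * (\<theta> * \<kappa>\<^sub>g * \<tau> / \<zeta>) * (sqrt M + ((norm e)\<^sup>2 - M) / (2 * sqrt M))"
    using real_le_sqrt_affine_square[OF pos(10), of "norm e"] pos \<kappa> H(3)
    by (intro mult_left_mono) auto
  moreover have "\<nu> * (1/2 * \<sigma> * (\<kappa>\<^sub>v * \<sigma>\<^sub>J\<^sup>2 * norm (c x))) \<le> \<nu> * (1/2 * \<sigma> * R)"
    using R(3) pos by (intro mult_left_mono) auto
  ultimately show ?thesis
    unfolding A_def[symmetric] using step lin quad we
    by (simp add: algebra_simps add_divide_distrib diff_divide_distrib)
qed

section \<open>Residual, expectations and the convergence rate\<close>

text \<open>Stationarity places \<open>b + H *v v + H *v u\<close> in the range of
  \<open>transpose J\<close>, where the pseudoinverse reproduces it exactly, so the multiplier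
  cancels everything except \<open>H *v (v + u)\<close>.\<close>

lemma stationarity_residual:
  fixes J :: "real^'n^'m"
  assumes "rank J = CARD('m)" and "stationary H J (b + H *v v) u"
    and "y = - (pseudoinverse (transpose J) *v (b + H *v v + H *v u))"
  shows "b + transpose J *v y = - (H *v (v + u))"
proof -
  obtain z where z: "b + H *v v + H *v u = transpose J *v z"
    using orthogonal_null_space_imp_range_transpose[OF assms(1)] assms(2) stationary_def by metis
  have "transpose J *v y = - (transpose J *v (pseudoinverse (transpose J) *v (transpose J *v z)))"
    using matrix_vector_mult_diff_distrib[of "transpose J" 0] by (simp add: assms(3) z)
  also have "\<dots> = - (b + H *v v + H *v u)"
    by (simp only: transpose_mult_pseudoinverse[OF assms(1)] z)
  finally have Jy: "transpose J *v y = - (b + H *v v + H *v u)" .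
  show ?thesis unfolding Jy by (simp add: matrix_vector_right_distrib)
qed

text \<open>Pythagoras splits \<open>v + u\<close> without a cross term. In the bound on
  \<open>(norm v)\<^sup>2\<close> one of the two factors \<open>norm c\<close> is replaced by
  \<open>\<kappa>\<^sub>c\<close>, because only the sum of first powers of \<open>norm c\<close> is
  controlled.\<close>

lemma stationarity_residual_bound:
  fixes J :: "real^'n^'m"
  assumes "J *v u = 0" and "v \<in> range ((*v) (transpose J))" and "norm v \<le> \<omega> * norm (transpose J *v c)"
    and "induced_norm H \<le> \<kappa>\<^sub>H" and "induced_norm J \<le> \<kappa>\<^sub>J" and "norm c \<le> \<kappa>\<^sub>c" and "0 \<le> \<omega>"
    and "0 < \<zeta>" and "\<zeta> * (norm u)\<^sup>2 \<le> u \<bullet> (H *v u)"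
  shows "(norm (H *v (v + u)))\<^sup>2
    \<le> \<kappa>\<^sub>H\<^sup>2 * ((u \<bullet> (H *v u)) / \<zeta> + \<omega>\<^sup>2 * \<kappa>\<^sub>J\<^sup>2 * \<kappa>\<^sub>c * norm c)"
proof -
  have \<kappa>: "0 \<le> \<kappa>\<^sub>H" "0 \<le> \<kappa>\<^sub>J"
    using assms(4,5) induced_norm_nonneg by (meson order_trans)+
  have "norm (H *v (v + u)) \<le> \<kappa>\<^sub>H * norm (v + u)"
    using norm_matrix_vector_le_induced_norm mult_right_mono[OF assms(4) norm_ge_zero]
    by (meson order_trans)
  then have "(norm (H *v (v + u)))\<^sup>2 \<le> \<kappa>\<^sub>H\<^sup>2 * (norm (v + u))\<^sup>2"
    by (metis norm_ge_zero power_mono power_mult_distrib)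
  also have "(norm (v + u))\<^sup>2 = (norm v)\<^sup>2 + (norm u)\<^sup>2"
    using assms(1,2)
    by (intro norm_add_Pythagorean) (auto simp: orthogonal_def simp flip: inner_matrix_vector_transpose)
  also have "(norm u)\<^sup>2 \<le> (u \<bullet> (H *v u)) / \<zeta>"
    using assms(8,9) by (simp add: field_simps)
  also have "(norm v)\<^sup>2 \<le> \<omega>\<^sup>2 * \<kappa>\<^sub>J\<^sup>2 * \<kappa>\<^sub>c * norm c"
  proof -
    have "norm (transpose J *v c) \<le> \<kappa>\<^sub>J * norm c"
      using norm_transpose_matrix_vector_le mult_right_mono[OF assms(5) norm_ge_zero]
      by (meson order_trans)
    then have "norm v \<le> \<omega> * (\<kappa>\<^sub>J * norm c)"
      using assms(3,7) by (meson mult_left_mono order_trans)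
    then have "(norm v)\<^sup>2 \<le> (\<omega> * (\<kappa>\<^sub>J * norm c))\<^sup>2"
      by (rule power_mono) simp
    also have "\<dots> = \<omega>\<^sup>2 * \<kappa>\<^sub>J\<^sup>2 * (norm c * norm c)"
      by (simp add: power_mult_distrib power2_eq_square)
    also have "\<dots> \<le> \<omega>\<^sup>2 * \<kappa>\<^sub>J\<^sup>2 * (\<kappa>\<^sub>c * norm c)"
      using assms(6) by (intro mult_left_mono mult_right_mono) auto
    finally show ?thesis by simp
  qed
  finally show ?thesis by (simp add: mult_left_mono add.commute)
qed

text \<open>Continuity is available on \<open>X\<close> only, so \<open>h\<close> is extended by
  zero outside this open set; along \<open>x\<close> the extension agrees with
  \<open>h\<close>.\<close>

lemma borel_measurable_continuous_on_open_compose: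
  fixes h :: "'a::euclidean_space \<Rightarrow> 'b::real_normed_vector"
  assumes "continuous_on X h" and "open X" and "x \<in> borel_measurable F"
    and "\<And>s. s \<in> space F \<Longrightarrow> x s \<in> X"
  shows "(\<lambda>s. h (x s)) \<in> borel_measurable F"
proof -
  have "(\<lambda>y. indicator X y *\<^sub>R h y) \<in> borel_measurable borel"
    using assms(1,2) by (intro borel_measurable_continuous_on_indicator) auto
  from measurable_compose[OF assms(3) this] show ?thesis
    by (rule measurable_cong[THEN iffD1, rotated]) (use assms(4) in auto)
qed

text \<open>Integrating the conditional variance bound gives the second moment. For the mean, the
  conditional expectation is scalar, so the argument runs componentwise: the bounded
  \<open>F\<close>-measurable weight is pulled through it.\<close>

lemma noise_moments:
  fixes g G w :: "'w \<Rightarrow> real^'n"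
  assumes "prob_space P" and "subalgebra P F"
    and g: "g \<in> borel_measurable P" and G: "G \<in> borel_measurable F" and w: "w \<in> borel_measurable F"
    and wb: "\<And>s. s \<in> space P \<Longrightarrow> norm (w s) \<le> B"
    and Gb: "\<And>s. s \<in> space P \<Longrightarrow> norm (G s) \<le> C"
    and mean: "\<And>i. AE s in P. real_cond_exp P F (\<lambda>s. g s $ i) s = G s $ i"
    and var: "AE s in P. nn_cond_exp P F (\<lambda>s. ennreal ((norm (g s - G s))\<^sup>2)) s \<le> ennreal M"
    and "0 \<le> M"
  shows "integrable P (\<lambda>s. (norm (g s - G s))\<^sup>2)"
    and "(\<integral>s. (norm (g s - G s))\<^sup>2 \<partial>P) \<le> M"
    and "integrable P (\<lambda>s. w s \<bullet> (g s - G s))"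
    and "(\<integral>s. w s \<bullet> (g s - G s) \<partial>P) = 0"
proof -
  interpret prob_space P by fact
  interpret finite_measure_subalgebra P F
    by unfold_locales fact
  have GP: "G \<in> borel_measurable P" and wP: "w \<in> borel_measurable P"
    using G w measurable_from_subalg[OF assms(2)] by auto
  note [measurable] = g GP wP
  have comp: "(\<lambda>s. g s $ i) \<in> borel_measurable P" "(\<lambda>s. w s $ i) \<in> borel_measurable F"
    "(\<lambda>s. w s $ i) \<in> borel_measurable P" "(\<lambda>s. G s $ i) \<in> borel_measurable P" for i
    using g w wP GP by (auto simp: borel_measurable_vec_iff)
  note [measurable] = comp(1,3,4)
  \<comment> \<open>The factor 1 is the weight in the defining integral identity of
    \<open>nn_cond_exp\<close>.\<close>
  have "(\<integral>\<^sup>+ s. ennreal ((norm (g s - G s))\<^sup>2) \<partial>P)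
      = (\<integral>\<^sup>+ s. 1 * nn_cond_exp P F (\<lambda>s. ennreal ((norm (g s - G s))\<^sup>2)) s \<partial>P)"
    by (subst nn_cond_exp_intg) auto
  also have "\<dots> \<le> (\<integral>\<^sup>+ s. ennreal M \<partial>P)"
    using var by (intro nn_integral_mono_AE) auto
  also have "\<dots> = ennreal M" by (simp add: emeasure_space_1)
  finally have nn: "(\<integral>\<^sup>+ s. ennreal ((norm (g s - G s))\<^sup>2) \<partial>P) \<le> ennreal M" .
  show sq: "integrable P (\<lambda>s. (norm (g s - G s))\<^sup>2)"
  proof (rule integrableI_bounded)
    show "(\<integral>\<^sup>+ s. ennreal (norm ((norm (g s - G s))\<^sup>2)) \<partial>P) < \<infinity>"
      using nn by (simp add: order.strict_trans1)
  qed measurable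
  show "(\<integral>s. (norm (g s - G s))\<^sup>2 \<partial>P) \<le> M"
    using nn \<open>0 \<le> M\<close> by (simp add: nn_integral_eq_integral[OF sq])
  have wi: "\<bar>w s $ i\<bar> \<le> B" if "s \<in> space P" for s i
    using component_le_norm_cart[of "w s" i] wb[OF that] by simp
  have Gi: "\<bar>G s $ i\<bar> \<le> C" if "s \<in> space P" for s i
    using component_le_norm_cart[of "G s" i] Gb[OF that] by simp
  have B0: "0 \<le> B"
    using wb not_empty norm_ge_zero by (meson all_not_in_conv order_trans)
  have we: "integrable P (\<lambda>s. w s $ i * (g s $ i - G s $ i))" for i
  proof (rule Bochner_Integration.integrable_bound)
    \<comment> \<open>Since \<open>z \<le> 1 + z\<^sup>2\<close>, square integrability of the noise
      supplies the dominating function.\<close>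
    show "integrable P (\<lambda>s. B * (1 + (norm (g s - G s))\<^sup>2))"
      using sq by simp
    show "AE s in P. norm (w s $ i * (g s $ i - G s $ i)) \<le> norm (B * (1 + (norm (g s - G s))\<^sup>2))"
    proof (rule AE_I2)
      fix s assume s: "s \<in> space P"
      have "\<bar>g s $ i - G s $ i\<bar> \<le> norm (g s - G s)"
        using component_le_norm_cart[of "g s - G s" i] by simp
      also have "\<dots> \<le> 1 + (norm (g s - G s))\<^sup>2"
        using zero_le_power2[of "norm (g s - G s) - 1"] zero_le_power2[of "norm (g s - G s)"]
        unfolding power2_diff power_one mult_1_right by linarith
      finally have "\<bar>w s $ i\<bar> * \<bar>g s $ i - G s $ i\<bar> \<le> B * (1 + (norm (g s - G s))\<^sup>2)"
        using wi[OF s] B0 by (intro mult_mono) auto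
      then show "norm (w s $ i * (g s $ i - G s $ i)) \<le> norm (B * (1 + (norm (g s - G s))\<^sup>2))"
        using B0 by (simp add: abs_mult)
    qed
  qed measurable
  have wG: "integrable P (\<lambda>s. w s $ i * G s $ i)" for i
  proof (rule integrable_const_bound)
    show "AE s in P. norm (w s $ i * G s $ i) \<le> B * C"
      using wi Gi B0 by (intro AE_I2) (auto simp: abs_mult intro!: mult_mono)
  qed measurable
  have wg: "integrable P (\<lambda>s. w s $ i * g s $ i)" for i
    using Bochner_Integration.integrable_add[OF we[of i] wG[of i]] by (simp add: algebra_simps)
  have zero: "(\<integral>s. w s $ i * (g s $ i - G s $ i) \<partial>P) = 0" for i
  proof -
    have "(\<integral>s. w s $ i * g s $ i \<partial>P) = (\<integral>s. w s $ i * real_cond_exp P F (\<lambda>s. g s $ i) s \<partial>P)"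
      using real_cond_exp_intg(2)[OF wg comp(2,1)] by simp
    also have "\<dots> = (\<integral>s. w s $ i * G s $ i \<partial>P)"
      using mean[of i] by (intro integral_cong_AE) auto
    finally show ?thesis
      using wg wG by (simp add: right_diff_distrib)
  qed
  show "integrable P (\<lambda>s. w s \<bullet> (g s - G s))"
    unfolding inner_vec_def using we by (intro Bochner_Integration.integrable_sum) simp
  show "(\<integral>s. w s \<bullet> (g s - G s) \<partial>P) = 0"
    unfolding inner_vec_def using we zero by (subst Bochner_Integration.integral_sum) auto
qed

lemma sum_le_of_descent:
  fixes E D :: "nat \<Rightarrow> real"
  assumes "\<And>k. E (Suc k) \<le> E k - D k + C"
  shows "(\<Sum>k<K. D k) \<le> E 0 - E K + real K * C"
proof (induction K)
  case (Suc K)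
  with assms[of K] show ?case by (simp add: algebra_simps)
qed simp

theorem theorem3p17:
  fixes P :: "'w measure" and F :: "nat \<Rightarrow> 'w measure"
    and X :: "(real^'n) set"
    and f :: "real^'n \<Rightarrow> real" and grad_f :: "real^'n \<Rightarrow> real^'n"
    and c :: "real^'n \<Rightarrow> real^'m" and J :: "real^'n \<Rightarrow> real^'n^'m"
    and x v g u d u_true :: "nat \<Rightarrow> 'w \<Rightarrow> real^'n" and H :: "nat \<Rightarrow> 'w \<Rightarrow> real^'n^'n"
    and \<alpha> :: "nat \<Rightarrow> 'w \<Rightarrow> real" and y_true :: "nat \<Rightarrow> 'w \<Rightarrow> real^'m"
    and \<beta> :: "nat \<Rightarrow> real" and x\<^sub>0 :: "real^'n" and K :: nat
    and L \<Gamma> M \<omega> \<epsilon>\<^sub>v \<zeta> \<sigma> \<sigma>\<^sub>J \<eta> \<theta> \<nu> \<tau>min f_inf :: real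
    and \<kappa>\<^sub>g \<kappa>\<^sub>c \<kappa>\<^sub>J \<kappa>\<^sub>H \<kappa>\<^sub>\<beta> \<kappa>\<^sub>v \<kappa>\<^sub>u \<kappa>\<^sub>0 \<kappa>\<^sub>1 \<kappa>\<^sub>2 :: real
  assumes "prob_space P"
    and "history P F x H v"
    and "\<And>k. \<alpha> k \<in> borel_measurable P"
    \<comment> \<open>smoothness and the resulting bounds along the iterates\<close>
    and "smoothness_assumption X f grad_f c J L \<Gamma>"
    and "\<And>k s. s \<in> space P \<Longrightarrow> x k s \<in> X"
    and "\<kappa>\<^sub>g > 0" and "\<kappa>\<^sub>c > 0" and "\<kappa>\<^sub>J > 0"
    and "\<And>k s. s \<in> space P \<Longrightarrow> f_inf \<le> f (x k s)"
    and "\<And>k s. s \<in> space P \<Longrightarrow> norm (grad_f (x k s)) \<le> \<kappa>\<^sub>g"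
    and "\<And>k s. s \<in> space P \<Longrightarrow> norm (c (x k s)) \<le> \<kappa>\<^sub>c"
    and "\<And>k s. s \<in> space P \<Longrightarrow> induced_norm (J (x k s)) \<le> \<kappa>\<^sub>J"
    \<comment> \<open>Hessian, stochastic gradient and constraint qualification\<close>
    and "\<zeta> > 0"
    and "\<And>s. s \<in> space P \<Longrightarrow> hessian_assumption J \<kappa>\<^sub>H \<zeta> (\<lambda>k. x k s) (\<lambda>k. H k s)"
    and "M > 0"
    and "gradient_assumption P F grad_f M x g"
    and "\<sigma>\<^sub>J > 0"
    and "\<And>s. s \<in> space P \<Longrightarrow> licq_assumption c J \<sigma>\<^sub>J (\<lambda>k. x k s)"
    \<comment> \<open>the algorithm\<close>
    and "\<omega> > 0" and "0 < \<epsilon>\<^sub>v" and "\<epsilon>\<^sub>v \<le> 1"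
    and "\<kappa>\<^sub>\<beta> > 0" and "\<And>k. 0 < \<beta> k" and "\<And>k. \<beta> k \<le> \<kappa>\<^sub>\<beta>"
    and "\<And>s. s \<in> space P \<Longrightarrow>
      exact_algorithm c J \<omega> \<epsilon>\<^sub>v \<beta> x\<^sub>0 (\<lambda>k. x k s) (\<lambda>k. H k s) (\<lambda>k. v k s)
        (\<lambda>k. g k s) (\<lambda>k. u k s) (\<lambda>k. d k s) (\<lambda>k. \<alpha> k s)"
    and "\<And>k s. s \<in> space P \<Longrightarrow>
      tangential_step (grad_f (x k s)) (H k s) (J (x k s)) (v k s) (u_true k s)"
    and "\<And>k s. s \<in> space P \<Longrightarrow>
      y_true k s = - (pseudoinverse (transpose (J (x k s))) *v
                      (grad_f (x k s) + H k s *v v k s + H k s *v u_true k s))"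
    \<comment> \<open>the constants\<close>
    and "0 < \<sigma>" and "\<sigma> < 1"
    and "\<kappa>\<^sub>v > 0"
    and "\<And>k s. s \<in> space P \<Longrightarrow>
      norm (c (x k s)) * (norm (c (x k s)) - norm (c (x k s) + J (x k s) *v v k s))
        \<ge> \<kappa>\<^sub>v * (norm (transpose (J (x k s)) *v c (x k s)))\<^sup>2"
    and "\<kappa>\<^sub>u = (1 / \<zeta>) * (\<kappa>\<^sub>g + \<kappa>\<^sub>H * \<omega> * \<kappa>\<^sub>J * \<kappa>\<^sub>c)"
    and "\<tau>min = (1 - \<sigma>) * \<kappa>\<^sub>v * \<sigma>\<^sub>J / (\<omega> * (\<kappa>\<^sub>\<beta> * \<kappa>\<^sub>H * \<kappa>\<^sub>u + \<kappa>\<^sub>g))"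
    and "\<kappa>\<^sub>0 = \<omega>\<^sup>2 * (2 * \<kappa>\<^sub>H + 2 * (1 / \<zeta>) * \<kappa>\<^sub>H\<^sup>2 + \<zeta>)"
    and "\<kappa>\<^sub>1 = 1/2 * (\<tau>min * L + \<Gamma>) * ((1 / \<zeta>) * \<kappa>\<^sub>H * \<kappa>\<^sub>u\<^sup>2 + (1 / \<zeta>\<^sup>2) * M)
              + \<theta> * \<kappa>\<^sub>g * \<tau>min * (1 / \<zeta>) * sqrt M
              + \<theta>\<^sup>2 * (\<tau>min * L + \<Gamma>) * \<omega>\<^sup>2 * \<kappa>\<^sub>J\<^sup>2 * \<kappa>\<^sub>c\<^sup>2"
    and "\<kappa>\<^sub>2 = \<tau>min * (f x\<^sub>0 - f_inf) + norm (c x\<^sub>0) + \<eta>\<^sup>2 * \<kappa>\<^sub>1"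
    \<comment> \<open>the choice of the step sizes for the horizon \<open>K\<close>\<close>
    and "K \<ge> 1" and "\<eta> > 0" and "\<theta> > 0"
    and "\<And>k. \<beta> k = \<eta> / sqrt (real K)"
    and "0 < \<nu>"
    and "\<nu> \<le> min (\<sigma> * \<kappa>\<^sub>v * (1 / \<kappa>\<^sub>c) / (2 * (\<tau>min * L + \<Gamma>) * \<omega>\<^sup>2)) (1 - \<theta> * \<kappa>\<^sub>\<beta>)"
    and "\<And>k s. s \<in> space P \<Longrightarrow> \<alpha> k s \<in> {\<nu> .. \<nu> + \<theta> * \<beta> k}"
  shows "(\<forall>k<K. integrable P (\<lambda>s. norm (c (x k s)))) \<and>
    (1 / real K) * (\<Sum>k<K. \<integral>s. norm (c (x k s)) \<partial>P)
      \<le> 2 * \<kappa>\<^sub>2 / (\<nu> * \<sigma> * \<kappa>\<^sub>v * \<sigma>\<^sub>J\<^sup>2 * real K) \<and>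
    (\<forall>k<K. integrable P
       (\<lambda>s. (norm (grad_f (x k s) + transpose (J (x k s)) *v y_true k s))\<^sup>2)) \<and>
    (1 / real K) *
      (\<Sum>k<K. \<integral>s. (norm (grad_f (x k s) + transpose (J (x k s)) *v y_true k s))\<^sup>2 \<partial>P)
      \<le> 2 * \<kappa>\<^sub>H\<^sup>2 * \<kappa>\<^sub>2 / (\<nu> * \<eta> * \<tau>min * \<zeta> * sqrt (real K))
        + 4 * \<kappa>\<^sub>2 * \<kappa>\<^sub>H\<^sup>2 * \<kappa>\<^sub>0 * \<kappa>\<^sub>J\<^sup>2 * \<kappa>\<^sub>c / (\<nu> * \<sigma> * \<kappa>\<^sub>v * \<sigma>\<^sub>J\<^sup>2 * \<zeta> * real K)"
proof -

  \<comment> \<open>The assumptions in pointwise form\<close>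
  interpret prob_space P by fact
  define b where "b = \<eta> / sqrt (real K)"
  define T where "T = \<tau>min * L + \<Gamma>"
  have \<beta>: "\<beta> k = b" for k by (simp add: assms(40) b_def)
  have b: "0 < b" "b \<le> \<kappa>\<^sub>\<beta>" using assms(23,24) \<beta> by auto
  \<comment> \<open>The sign of \<open>\<kappa>\<^sub>H\<close> is obtained below from the Hessian
    bound at one outcome.\<close>
  obtain s\<^sub>0 where s\<^sub>0: "s\<^sub>0 \<in> space P" using not_empty by blast

  have sm: "open X" "0 < L" "0 < \<Gamma>" "continuous_on X grad_f" "continuous_on X J"
      "\<And>y. y \<in> X \<Longrightarrow> GDERIV f y :> grad_f y"
      "\<And>y. y \<in> X \<Longrightarrow> (c has_derivative (*v) (J y)) (at y)" "bounded (f ` X)"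
    using assms(4) by (auto simp: smoothness_assumption_def)
  have fcont: "continuous_on X f" and ccont: "continuous_on X c"
    using sm(6,7) by (auto simp: gderiv_def intro!: continuous_at_imp_continuous_on
        dest!: has_derivative_continuous)
  have subF: "subalgebra P (F k)" and meas: "x k \<in> borel_measurable (F k)"
      "H k \<in> borel_measurable (F k)" "v k \<in> borel_measurable (F k)" for k
    using assms(2) by (auto simp: history_def)
  have spF: "space (F k) = space P" for k using subF by (simp add: subalgebra_def)
  have xF: "x k s \<in> X" if "s \<in> space (F k)" for k s using assms(5) that by (simp add: spF)
  have hess: "transpose (H k s) = H k s" "induced_norm (H k s) \<le> \<kappa>\<^sub>H"
      "\<And>u. J (x k s) *v u = 0 \<Longrightarrow> \<zeta> * (norm u)\<^sup>2 \<le> u \<bullet> (H k s *v u)" if "s \<in> space P" for k s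
    using assms(14)[OF that] by (auto simp: hessian_assumption_def)
  have licq: "rank (J (x k s)) = CARD('m)"
      "\<sigma>\<^sub>J * norm (c (x k s)) \<le> norm (transpose (J (x k s)) *v c (x k s))" if "s \<in> space P" for k s
    using assms(18)[OF that] by (auto simp: licq_assumption_def)
  have alg: "x 0 s = x\<^sub>0" "v k s \<in> range ((*v) (transpose (J (x k s))))"
      "norm (v k s) \<le> \<omega> * norm (transpose (J (x k s)) *v c (x k s))"
      "tangential_step (g k s) (H k s) (J (x k s)) (v k s) (u k s)"
      "d k s = b *\<^sub>R u k s + v k s" "x (Suc k) s = x k s + \<alpha> k s *\<^sub>R d k s" if "s \<in> space P" for k s
    using assms(25)[OF that] by (auto simp: exact_algorithm_def normal_step_def \<beta>)

  \<comment> \<open>Signs of the constants and the stepsize conditions\<close>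
  have \<kappa>H: "0 \<le> \<kappa>\<^sub>H" using hess(2)[OF s\<^sub>0] induced_norm_nonneg order_trans by blast
  have \<kappa>u: "0 \<le> \<kappa>\<^sub>u" unfolding assms(32) using \<kappa>H assms(6,7,8,13,19) by simp
  have den: "0 < \<omega> * (\<kappa>\<^sub>\<beta> * \<kappa>\<^sub>H * \<kappa>\<^sub>u + \<kappa>\<^sub>g)"
    using \<kappa>H \<kappa>u assms(6,19,22) by (intro mult_pos_pos add_nonneg_pos) auto
  have \<tau>pos: "0 < \<tau>min" unfolding assms(33) using den assms(17,29,30) by simp
  have \<tau>eq: "\<tau>min * (\<omega> * (\<kappa>\<^sub>\<beta> * \<kappa>\<^sub>H * \<kappa>\<^sub>u + \<kappa>\<^sub>g)) = (1 - \<sigma>) * \<kappa>\<^sub>v * \<sigma>\<^sub>J"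
    unfolding assms(33) using nonzero_eq_divide_eq[OF less_imp_neq[OF den, THEN not_sym]] by blast
  have Tpos: "0 < T" unfolding T_def using \<tau>pos sm(2,3) by (simp add: add_pos_pos)
  have \<nu>1: "\<nu> * (2 * T * \<omega>\<^sup>2) \<le> \<sigma> * \<kappa>\<^sub>v / \<kappa>\<^sub>c"
  proof -
    have "\<nu> \<le> \<sigma> * \<kappa>\<^sub>v * (1 / \<kappa>\<^sub>c) / (2 * T * \<omega>\<^sup>2)" using assms(42) by (simp add: T_def)
    moreover have "0 < 2 * T * \<omega>\<^sup>2" using Tpos assms(19) by simp
    ultimately have "\<nu> * (2 * T * \<omega>\<^sup>2) \<le> \<sigma> * \<kappa>\<^sub>v * (1 / \<kappa>\<^sub>c)"
      by (rule pos_le_divide_eq[THEN iffD1, rotated])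
    then show ?thesis by simp
  qed
  have \<nu>2: "\<nu> + \<theta> * b \<le> 1"
    using assms(42) mult_left_mono[OF b(2) less_imp_le[OF assms(39)]] by linarith

  \<comment> \<open>The random quantities of the one-step estimate\<close>
  define ut where "ut k s = u_true k s" for k s
  \<comment> \<open>The known vector paired with the step error \<open>u - ut\<close> in the
    one-step estimate; \<open>w\<close> is its image under the solution operator and pairs with the
    noise.\<close>
  define a where "a k s = (\<nu> * \<tau>min * b) *\<^sub>R grad_f (x k s) + (T * b\<^sup>2) *\<^sub>R ut k s" for k s
  define w where "w k s = kkt_solution (H k s) (J (x k s)) (a k s)" for k s
  define e where "e k s = g k s - grad_f (x k s)" for k s
  define A where "A k s = ut k s \<bullet> (H k s *v ut k s)" for k s
  define nc where "nc k s = norm (c (x k s))" for k s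
  define Q where "Q k s = (norm (H k s *v (v k s + ut k s)))\<^sup>2" for k s
  define \<phi> where "\<phi> k s = \<tau>min * f (x k s) + nc k s" for k s
  define B where "B = b\<^sup>2 * (1/2 * T / \<zeta>\<^sup>2 + \<theta> * \<kappa>\<^sub>g * \<tau>min / \<zeta> / (2 * sqrt M))"

  have st_iff: "stationary (H k s) (J (x k s)) r z \<longleftrightarrow> z = kkt_solution (H k s) (J (x k s)) r"
    if "s \<in> space P" for k s r z
    by (rule stationary_iff_kkt_solution[OF licq(1)[OF that] hess(3)[OF that] assms(13)])
  have ut_st: "stationary (H k s) (J (x k s)) (grad_f (x k s) + H k s *v v k s) (ut k s)"
    if "s \<in> space P" for k s
    unfolding ut_def using assms(26)[OF that] hess(1)[OF that] by (rule tangential_step_imp_stationary)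
  have w_st: "stationary (H k s) (J (x k s)) (a k s) (w k s)" if "s \<in> space P" for k s
    using st_iff[OF that] by (simp add: w_def)
  have u_st: "stationary (H k s) (J (x k s)) (grad_f (x k s) + e k s + H k s *v v k s) (u k s)"
    if "s \<in> space P" for k s
    using tangential_step_imp_stationary[OF alg(4)[OF that] hess(1)[OF that]] by (simp add: e_def)
  have st_norm: "norm z \<le> norm r / \<zeta>" if "s \<in> space P" "stationary (H k s) (J (x k s)) r z" for k s r z
    using that hess(3)[OF that(1)] assms(13) by (intro stationary_norm_le[OF that(2)]) (auto simp: stationary_def)

  \<comment> \<open>Uniform bounds on steps, weights and curvature\<close>
  have v_norm: "norm (v k s) \<le> \<omega> * (\<kappa>\<^sub>J * \<kappa>\<^sub>c)" if "s \<in> space P" for k s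
  proof -
    have "norm (transpose (J (x k s)) *v c (x k s)) \<le> \<kappa>\<^sub>J * \<kappa>\<^sub>c"
      by (rule order_trans[OF norm_transpose_matrix_vector_le])
         (use assms(8) assms(11,12)[OF that] in \<open>auto intro!: mult_mono\<close>)
    with alg(3)[OF that] show ?thesis
      using assms(19) by (meson less_imp_le mult_left_mono order_trans)
  qed
  have Hz: "norm (H k s *v z) \<le> \<kappa>\<^sub>H * norm z" if "s \<in> space P" for k s z
    using norm_matrix_vector_le_induced_norm mult_right_mono[OF hess(2)[OF that] norm_ge_zero]
    by (meson order_trans)
  have ut_norm: "norm (ut k s) \<le> \<kappa>\<^sub>u" if "s \<in> space P" for k s
  proof -
    have "norm (H k s *v v k s) \<le> \<kappa>\<^sub>H * (\<omega> * (\<kappa>\<^sub>J * \<kappa>\<^sub>c))"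
      using Hz[OF that] mult_left_mono[OF v_norm[OF that] \<kappa>H] by (meson order_trans)
    then have "norm (grad_f (x k s) + H k s *v v k s) \<le> \<kappa>\<^sub>g + \<kappa>\<^sub>H * \<omega> * \<kappa>\<^sub>J * \<kappa>\<^sub>c"
      using norm_triangle_ineq[of "grad_f (x k s)" "H k s *v v k s"] assms(10)[OF that, of k]
      by (simp add: mult.assoc)
    then have "norm (grad_f (x k s) + H k s *v v k s) / \<zeta> \<le> \<kappa>\<^sub>u"
      using assms(13) by (simp add: assms(32) divide_right_mono)
    with st_norm[OF that ut_st[OF that]] show ?thesis by (rule order_trans)
  qed
  have w_norm: "norm (w k s) \<le> (\<nu> * \<tau>min * b * \<kappa>\<^sub>g + T * b\<^sup>2 * \<kappa>\<^sub>u) / \<zeta>" if "s \<in> space P" for k s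
  proof -
    have "norm (a k s) \<le> \<nu> * \<tau>min * b * norm (grad_f (x k s)) + T * b\<^sup>2 * norm (ut k s)"
      using norm_triangle_ineq[of "(\<nu> * \<tau>min * b) *\<^sub>R grad_f (x k s)" "(T * b\<^sup>2) *\<^sub>R ut k s"]
        assms(41) \<tau>pos b(1) Tpos by (simp add: a_def abs_mult)
    also have "\<dots> \<le> \<nu> * \<tau>min * b * \<kappa>\<^sub>g + T * b\<^sup>2 * \<kappa>\<^sub>u"
      using assms(10)[OF that] ut_norm[OF that] assms(41) \<tau>pos b(1) Tpos
      by (intro add_mono mult_left_mono) auto
    finally have "norm (a k s) / \<zeta> \<le> (\<nu> * \<tau>min * b * \<kappa>\<^sub>g + T * b\<^sup>2 * \<kappa>\<^sub>u) / \<zeta>"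
      using assms(13) by (simp add: divide_right_mono)
    with st_norm[OF that w_st[OF that]] show ?thesis by (rule order_trans)
  qed
  have A_bounds: "0 \<le> A k s" "A k s \<le> \<kappa>\<^sub>u * (\<kappa>\<^sub>H * \<kappa>\<^sub>u)" if "s \<in> space P" for k s
  proof -
    show "0 \<le> A k s"
      using hess(3)[OF that, of k "ut k s"] ut_st[OF that] assms(13) unfolding A_def stationary_def
      by (meson less_imp_le mult_nonneg_nonneg order_trans zero_le_power2)
    have "A k s \<le> norm (ut k s) * norm (H k s *v ut k s)"
      unfolding A_def by (rule norm_cauchy_schwarz)
    also have "\<dots> \<le> \<kappa>\<^sub>u * (\<kappa>\<^sub>H * \<kappa>\<^sub>u)"
      using Hz[OF that, of k "ut k s"] ut_norm[OF that, of k] \<kappa>H \<kappa>u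
      by (intro mult_mono order_trans[OF Hz[OF that]] mult_left_mono) auto
    finally show "A k s \<le> \<kappa>\<^sub>u * (\<kappa>\<^sub>H * \<kappa>\<^sub>u)" .
  qed

  \<comment> \<open>Change of the merit function at each outcome\<close>
  have step: "\<phi> (Suc k) s \<le> \<phi> k s
      - \<nu> * (\<tau>min * b * A k s + 1/2 * \<sigma> * \<kappa>\<^sub>v * \<sigma>\<^sub>J\<^sup>2 * nc k s)
      + b\<^sup>2 * \<kappa>\<^sub>1 + B * ((norm (e k s))\<^sup>2 - M) + w k s \<bullet> e k s" if s: "s \<in> space P" for k s
  proof -
    have "x k s + \<alpha> k s *\<^sub>R d k s \<in> X" using assms(5)[OF s, of "Suc k"] alg(6)[OF s] by simp
    note one = merit_one_step[OF assms(4) assms(5)[OF s] this alg(5)[OF s] hess(1,2)[OF s] assms(13)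
        hess(3)[OF s] u_st[OF s] ut_st[OF s] w_st[OF s, unfolded a_def T_def] alg(2,3)[OF s]
        assms(10,11,12)[OF s] ut_norm[OF s] assms(31)[OF s] licq(2)[OF s] assms(30,17,7,28,29)
        \<tau>pos b(1) assms(41,39,15,19) b(2) \<tau>eq \<nu>1[unfolded T_def] \<nu>2]
    show ?thesis
      using one assms(43)[OF s, of k]
      by (simp add: \<phi>_def nc_def A_def B_def T_def alg(6)[OF s] assms(35) \<beta>)
  qed

  \<comment> \<open>Measurability and integrability\<close>
  have gradF: "(\<lambda>s. grad_f (x k s)) \<in> borel_measurable (F k)"
    and JF: "(\<lambda>s. J (x k s)) \<in> borel_measurable (F k)" for k
    using borel_measurable_continuous_on_open_compose[OF _ sm(1) meas(1) xF] sm(4,5) by auto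
  \<comment> \<open>The true step is given only as a minimizer at each outcome; its measurability
    comes from its agreement with the explicit solution formula.\<close>
  have utF: "ut k \<in> borel_measurable (F k)" for k
  proof -
    have "(\<lambda>s. kkt_solution (H k s) (J (x k s)) (grad_f (x k s) + H k s *v v k s)) \<in> borel_measurable (F k)"
      by (intro borel_measurable_kkt_solution borel_measurable_add borel_measurable_matrix_vector_mult
          meas gradF JF)
    then show ?thesis
      by (rule measurable_cong[THEN iffD1, rotated]) (use st_iff ut_st in \<open>auto simp: spF\<close>)
  qed
  have wF: "w k \<in> borel_measurable (F k)" for k
    unfolding w_def a_def
    by (intro borel_measurable_kkt_solution borel_measurable_add borel_measurable_scaleR
        borel_measurable_const meas gradF JF utF)
  note toP = measurable_from_subalg[OF subF]
  have A_int: "integrable P (A k)" for k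
  proof (rule integrable_const_bound)
    show "A k \<in> borel_measurable P" unfolding A_def
      by (intro borel_measurable_inner borel_measurable_matrix_vector_mult toP[OF utF] toP[OF meas(2)])
    show "AE s in P. norm (A k s) \<le> \<kappa>\<^sub>u * (\<kappa>\<^sub>H * \<kappa>\<^sub>u)"
      using A_bounds by (intro AE_I2) auto
  qed
  have nc_int: "integrable P (nc k)" for k
  proof (rule integrable_const_bound)
    show "nc k \<in> borel_measurable P" unfolding nc_def
      by (rule measurable_compose[OF toP borel_measurable_norm])
         (rule borel_measurable_continuous_on_open_compose[OF ccont sm(1) meas(1) xF])
    show "AE s in P. norm (nc k s) \<le> \<kappa>\<^sub>c"
      using assms(11) by (intro AE_I2) (auto simp: nc_def)
  qed
  have Q_int: "integrable P (Q k)" for k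
  proof (rule integrable_const_bound)
    show "Q k \<in> borel_measurable P" unfolding Q_def
      by (intro borel_measurable_power measurable_compose[OF _ borel_measurable_norm] borel_measurable_matrix_vector_mult
          borel_measurable_add toP[OF utF] toP[OF meas(2)] toP[OF meas(3)])
    show "AE s in P. norm (Q k s) \<le> (\<kappa>\<^sub>H * (\<omega> * (\<kappa>\<^sub>J * \<kappa>\<^sub>c) + \<kappa>\<^sub>u))\<^sup>2"
    proof (rule AE_I2)
      fix s assume s: "s \<in> space P"
      have "norm (v k s + ut k s) \<le> \<omega> * (\<kappa>\<^sub>J * \<kappa>\<^sub>c) + \<kappa>\<^sub>u"
        using norm_triangle_ineq[of "v k s" "ut k s"] v_norm[OF s, of k] ut_norm[OF s, of k] by linarith
      from order_trans[OF Hz[OF s] mult_left_mono[OF this \<kappa>H]]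
      show "norm (Q k s) \<le> (\<kappa>\<^sub>H * (\<omega> * (\<kappa>\<^sub>J * \<kappa>\<^sub>c) + \<kappa>\<^sub>u))\<^sup>2"
        unfolding Q_def by (simp add: power_mono)
    qed
  qed
  have f_int: "integrable P (\<lambda>s. f (x k s))" for k
  proof -
    obtain C where C: "\<And>y. y \<in> X \<Longrightarrow> \<bar>f y\<bar> \<le> C"
      using sm(8) by (auto simp: bounded_iff)
    show ?thesis
    proof (rule integrable_const_bound)
      show "(\<lambda>s. f (x k s)) \<in> borel_measurable P"
        by (rule toP[OF borel_measurable_continuous_on_open_compose[OF fcont sm(1) meas(1) xF]])
      show "AE s in P. norm (f (x k s)) \<le> C"
        using C assms(5) by (intro AE_I2) auto
    qed
  qed
  have \<phi>_int: "integrable P (\<phi> k)" for k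
    unfolding \<phi>_def using f_int nc_int by simp

  \<comment> \<open>Moments of the noise and descent in expectation\<close>
  have gm: "g k \<in> borel_measurable P"
      "AE s in P. real_cond_exp P (F k) (\<lambda>s. g k s $ i) s = grad_f (x k s) $ i"
      "AE s in P. nn_cond_exp P (F k) (\<lambda>s. ennreal ((norm (g k s - grad_f (x k s)))\<^sup>2)) s \<le> ennreal M"
    for k i
    using assms(16) by (auto simp: gradient_assumption_def)
  note noise = noise_moments[OF assms(1) subF gm(1) gradF wF w_norm assms(10) gm(2) gm(3)
      less_imp_le[OF assms(15)], folded e_def]
  have "0 \<le> B" unfolding B_def
    using b(1) Tpos assms(6,13,39,15) \<tau>pos by (intro mult_nonneg_nonneg add_nonneg_nonneg) auto

  define D where "D k = \<nu> * (\<tau>min * b * expectation (A k) + 1/2 * \<sigma> * \<kappa>\<^sub>v * \<sigma>\<^sub>J\<^sup>2 * expectation (nc k))" for k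
  have descent: "expectation (\<phi> (Suc k)) \<le> expectation (\<phi> k) - D k + b\<^sup>2 * \<kappa>\<^sub>1" for k
  proof -
    have "expectation (\<phi> (Suc k)) \<le> expectation (\<lambda>s. \<phi> k s
      - \<nu> * (\<tau>min * b * A k s + 1/2 * \<sigma> * \<kappa>\<^sub>v * \<sigma>\<^sub>J\<^sup>2 * nc k s)
      + b\<^sup>2 * \<kappa>\<^sub>1 + B * ((norm (e k s))\<^sup>2 - M) + w k s \<bullet> e k s)"
      using \<phi>_int A_int nc_int noise(1,3) by (intro integral_mono step) auto
    also have "\<dots> = expectation (\<phi> k) - D k + b\<^sup>2 * \<kappa>\<^sub>1 + B * (expectation (\<lambda>s. (norm (e k s))\<^sup>2) - M)"
      using \<phi>_int A_int nc_int noise(1,3,4) by (simp add: D_def prob_space)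
    also have "B * (expectation (\<lambda>s. (norm (e k s))\<^sup>2) - M) \<le> 0"
      using noise(2)[of k] \<open>0 \<le> B\<close> by (simp add: mult_nonneg_nonpos)
    finally show ?thesis by simp
  qed

  \<comment> \<open>Telescoping over the horizon\<close>
  have "expectation (\<phi> 0) = \<tau>min * f x\<^sub>0 + norm (c x\<^sub>0)"
  proof -
    have "expectation (\<phi> 0) = expectation (\<lambda>s. \<tau>min * f x\<^sub>0 + norm (c x\<^sub>0))"
      using alg(1) by (intro Bochner_Integration.integral_cong) (auto simp: \<phi>_def nc_def)
    then show ?thesis by (simp add: prob_space)
  qed
  moreover have "\<tau>min * f_inf \<le> expectation (\<phi> K)"
  proof -
    have "expectation (\<lambda>s. \<tau>min * f_inf) \<le> expectation (\<phi> K)"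
      using assms(9) \<tau>pos \<phi>_int
      by (intro integral_mono) (auto simp: \<phi>_def nc_def intro!: add_increasing2)
    then show ?thesis by (simp add: prob_space)
  qed
  \<comment> \<open>The choice of \<beta> makes the total error over \<open>K\<close> iterations
    independent of \<open>K\<close>.\<close>
  moreover have "real K * (b\<^sup>2 * \<kappa>\<^sub>1) = \<eta>\<^sup>2 * \<kappa>\<^sub>1"
    using assms(37) by (simp add: b_def power_divide)
  ultimately have sumD: "(\<Sum>k<K. D k) \<le> \<kappa>\<^sub>2"
    using sum_le_of_descent[of "\<lambda>k. expectation (\<phi> k)" D, OF descent, of K]
    unfolding assms(36) right_diff_distrib by linarith
  define SA where "SA = (\<Sum>k<K. expectation (A k))"
  define Sc where "Sc = (\<Sum>k<K. expectation (nc k))"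
  \<comment> \<open>Both sums are nonnegative, so either may be dropped from the combined bound,
    which yields a separate bound on the other.\<close>
  have SA0: "0 \<le> SA" and Sc0: "0 \<le> Sc"
    unfolding SA_def Sc_def using A_bounds
    by (auto intro!: sum_nonneg Bochner_Integration.integral_nonneg_AE AE_I2 simp: nc_def)
  have total: "\<nu> * \<tau>min * b * SA + 1/2 * (\<nu> * \<sigma> * \<kappa>\<^sub>v * \<sigma>\<^sub>J\<^sup>2) * Sc \<le> \<kappa>\<^sub>2"
    using sumD unfolding D_def SA_def Sc_def
    by (simp add: sum.distrib sum_distrib_left sum_divide_distrib algebra_simps)
  have pos1: "0 < \<nu> * \<tau>min * b" and pos2: "0 < \<nu> * \<sigma> * \<kappa>\<^sub>v * \<sigma>\<^sub>J\<^sup>2"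
    using assms(17,28,30,41) \<tau>pos b(1) by simp_all
  have "1/2 * (\<nu> * \<sigma> * \<kappa>\<^sub>v * \<sigma>\<^sub>J\<^sup>2) * Sc \<le> \<kappa>\<^sub>2"
    using total mult_nonneg_nonneg[OF less_imp_le[OF pos1] SA0] by linarith
  then have Sc: "Sc \<le> 2 * \<kappa>\<^sub>2 / (\<nu> * \<sigma> * \<kappa>\<^sub>v * \<sigma>\<^sub>J\<^sup>2)"
    using pos2 by (simp add: pos_le_divide_eq mult.commute)
  have "\<nu> * \<tau>min * b * SA \<le> \<kappa>\<^sub>2"
    using total mult_nonneg_nonneg[OF less_imp_le[OF pos2] Sc0] by linarith
  then have SA: "SA \<le> \<kappa>\<^sub>2 / (\<nu> * \<tau>min * b)"
    using pos1 by (simp add: pos_le_divide_eq mult.commute)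
  have K0: "0 < real K" using assms(37) by simp
  have \<kappa>2: "0 \<le> \<kappa>\<^sub>2" using total mult_nonneg_nonneg[OF less_imp_le[OF pos1] SA0]
      mult_nonneg_nonneg[OF less_imp_le[OF pos2] Sc0] by linarith

  \<comment> \<open>Expected squared stationarity residual\<close>
  have res: "(norm (grad_f (x k s) + transpose (J (x k s)) *v y_true k s))\<^sup>2 = Q k s"
    if "s \<in> space P" for k s
    using stationarity_residual[OF licq(1)[OF that] ut_st[OF that] assms(27)[OF that, folded ut_def]]
    by (simp add: Q_def)
  have res_int: "integrable P (\<lambda>s. (norm (grad_f (x k s) + transpose (J (x k s)) *v y_true k s))\<^sup>2)"
    and res_exp: "(\<integral>s. (norm (grad_f (x k s) + transpose (J (x k s)) *v y_true k s))\<^sup>2 \<partial>P)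
      = expectation (Q k)" for k
    using Q_int[of k] res by (auto cong: Bochner_Integration.integrable_cong Bochner_Integration.integral_cong)
  have Q_exp: "expectation (Q k)
      \<le> \<kappa>\<^sub>H\<^sup>2 / \<zeta> * expectation (A k) + \<kappa>\<^sub>H\<^sup>2 * (\<omega>\<^sup>2 * \<kappa>\<^sub>J\<^sup>2 * \<kappa>\<^sub>c) * expectation (nc k)" for k
  proof -
    have "expectation (Q k)
        \<le> expectation (\<lambda>s. \<kappa>\<^sub>H\<^sup>2 / \<zeta> * A k s + \<kappa>\<^sub>H\<^sup>2 * (\<omega>\<^sup>2 * \<kappa>\<^sub>J\<^sup>2 * \<kappa>\<^sub>c) * nc k s)"
    proof (intro integral_mono)
      fix s assume s: "s \<in> space P"
      have Ju: "J (x k s) *v ut k s = 0" using ut_st[OF s] by (simp add: stationary_def)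
      from stationarity_residual_bound[OF Ju alg(2,3)[OF s] hess(2)[OF s] assms(12,11)[OF s]
          less_imp_le[OF assms(19)] assms(13) hess(3)[OF s Ju]]
      show "Q k s \<le> \<kappa>\<^sub>H\<^sup>2 / \<zeta> * A k s + \<kappa>\<^sub>H\<^sup>2 * (\<omega>\<^sup>2 * \<kappa>\<^sub>J\<^sup>2 * \<kappa>\<^sub>c) * nc k s"
        by (simp add: Q_def A_def nc_def distrib_left mult.assoc)
    qed (use Q_int A_int nc_int in auto)
    also have "\<dots> = \<kappa>\<^sub>H\<^sup>2 / \<zeta> * expectation (A k) + \<kappa>\<^sub>H\<^sup>2 * (\<omega>\<^sup>2 * \<kappa>\<^sub>J\<^sup>2 * \<kappa>\<^sub>c) * expectation (nc k)"
      using A_int nc_int by simp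
    finally show ?thesis .
  qed
  have "(\<Sum>k<K. expectation (Q k)) \<le> \<kappa>\<^sub>H\<^sup>2 / \<zeta> * SA + \<kappa>\<^sub>H\<^sup>2 * (\<omega>\<^sup>2 * \<kappa>\<^sub>J\<^sup>2 * \<kappa>\<^sub>c) * Sc"
    using sum_mono[of "{..<K}", OF Q_exp] by (simp add: SA_def Sc_def sum.distrib sum_distrib_left)
  \<comment> \<open>Here the estimate is relaxed to the constants of the claim: the first term is
    doubled, and \<open>\<omega>\<^sup>2 \<le> 2 * \<kappa>\<^sub>0 / \<zeta>\<close> holds because
    \<open>\<kappa>\<^sub>0\<close> contains the summand
    \<open>\<omega>\<^sup>2 * \<zeta>\<close>.\<close>
  also have "\<dots> \<le> 2 * (\<kappa>\<^sub>H\<^sup>2 / \<zeta>) * (\<kappa>\<^sub>2 / (\<nu> * \<tau>min * b))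
      + \<kappa>\<^sub>H\<^sup>2 * (2 * \<kappa>\<^sub>0 / \<zeta> * \<kappa>\<^sub>J\<^sup>2 * \<kappa>\<^sub>c) * (2 * \<kappa>\<^sub>2 / (\<nu> * \<sigma> * \<kappa>\<^sub>v * \<sigma>\<^sub>J\<^sup>2))"
  proof (rule add_mono)
    have "\<kappa>\<^sub>H\<^sup>2 / \<zeta> * SA \<le> \<kappa>\<^sub>H\<^sup>2 / \<zeta> * (\<kappa>\<^sub>2 / (\<nu> * \<tau>min * b))"
      using SA assms(13) by (intro mult_left_mono) auto
    moreover have "0 \<le> \<kappa>\<^sub>H\<^sup>2 / \<zeta> * (\<kappa>\<^sub>2 / (\<nu> * \<tau>min * b))"
      using assms(13) \<kappa>2 pos1 by (intro mult_nonneg_nonneg divide_nonneg_pos) auto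
    ultimately show "\<kappa>\<^sub>H\<^sup>2 / \<zeta> * SA \<le> 2 * (\<kappa>\<^sub>H\<^sup>2 / \<zeta>) * (\<kappa>\<^sub>2 / (\<nu> * \<tau>min * b))"
      by linarith
    have "\<omega>\<^sup>2 * \<zeta> \<le> \<kappa>\<^sub>0" unfolding assms(34)
      using \<kappa>H assms(13) by (intro mult_left_mono) auto
    then have "\<omega>\<^sup>2 * \<zeta> \<le> 2 * \<kappa>\<^sub>0"
      using mult_nonneg_nonneg[OF zero_le_power2 less_imp_le[OF assms(13)], of \<omega>] by linarith
    then have "\<omega>\<^sup>2 \<le> 2 * \<kappa>\<^sub>0 / \<zeta>" using assms(13) by (simp add: pos_le_divide_eq)
    then have le: "\<kappa>\<^sub>H\<^sup>2 * (\<omega>\<^sup>2 * \<kappa>\<^sub>J\<^sup>2 * \<kappa>\<^sub>c) \<le> \<kappa>\<^sub>H\<^sup>2 * (2 * \<kappa>\<^sub>0 / \<zeta> * \<kappa>\<^sub>J\<^sup>2 * \<kappa>\<^sub>c)"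
      using assms(7) by (intro mult_left_mono mult_right_mono) auto
    moreover have "0 \<le> \<kappa>\<^sub>H\<^sup>2 * (\<omega>\<^sup>2 * \<kappa>\<^sub>J\<^sup>2 * \<kappa>\<^sub>c)" using assms(7) by simp
    ultimately show "\<kappa>\<^sub>H\<^sup>2 * (\<omega>\<^sup>2 * \<kappa>\<^sub>J\<^sup>2 * \<kappa>\<^sub>c) * Sc
        \<le> \<kappa>\<^sub>H\<^sup>2 * (2 * \<kappa>\<^sub>0 / \<zeta> * \<kappa>\<^sub>J\<^sup>2 * \<kappa>\<^sub>c) * (2 * \<kappa>\<^sub>2 / (\<nu> * \<sigma> * \<kappa>\<^sub>v * \<sigma>\<^sub>J\<^sup>2))"
      using Sc Sc0 by (intro mult_mono[OF le Sc]) linarith+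
  qed
  finally have SQ: "(\<Sum>k<K. expectation (Q k)) \<le> 2 * (\<kappa>\<^sub>H\<^sup>2 / \<zeta>) * (\<kappa>\<^sub>2 / (\<nu> * \<tau>min * b))
      + \<kappa>\<^sub>H\<^sup>2 * (2 * \<kappa>\<^sub>0 / \<zeta> * \<kappa>\<^sub>J\<^sup>2 * \<kappa>\<^sub>c) * (2 * \<kappa>\<^sub>2 / (\<nu> * \<sigma> * \<kappa>\<^sub>v * \<sigma>\<^sub>J\<^sup>2))" .
  have Kb: "real K * b = \<eta> * sqrt (real K)"
    using real_sqrt_mult_self[of "real K"] K0 by (simp add: b_def field_simps)

  \<comment> \<open>Averages over the horizon\<close>
  show ?thesis
  proof (intro conjI allI impI)
    show "integrable P (\<lambda>s. norm (c (x k s)))" for k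
      using nc_int[of k] by (simp only: nc_def[abs_def])
    show "1 / real K * (\<Sum>k<K. \<integral>s. norm (c (x k s)) \<partial>P) \<le> 2 * \<kappa>\<^sub>2 / (\<nu> * \<sigma> * \<kappa>\<^sub>v * \<sigma>\<^sub>J\<^sup>2 * real K)"
      using divide_right_mono[OF Sc, of "real K"] by (simp add: Sc_def nc_def[abs_def])
    show "integrable P (\<lambda>s. (norm (grad_f (x k s) + transpose (J (x k s)) *v y_true k s))\<^sup>2)" for k
      by (rule res_int)
    have "2 * (\<kappa>\<^sub>H\<^sup>2 / \<zeta>) * (\<kappa>\<^sub>2 / (\<nu> * \<tau>min * b)) / real K
        = 2 * \<kappa>\<^sub>H\<^sup>2 * \<kappa>\<^sub>2 / (\<nu> * \<tau>min * \<zeta> * (real K * b))"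
      by (simp add: mult_ac)
    also have "\<dots> = 2 * \<kappa>\<^sub>H\<^sup>2 * \<kappa>\<^sub>2 / (\<nu> * \<eta> * \<tau>min * \<zeta> * sqrt (real K))"
      unfolding Kb by (simp add: mult_ac)
    finally have 1: "2 * (\<kappa>\<^sub>H\<^sup>2 / \<zeta>) * (\<kappa>\<^sub>2 / (\<nu> * \<tau>min * b)) / real K
        = 2 * \<kappa>\<^sub>H\<^sup>2 * \<kappa>\<^sub>2 / (\<nu> * \<eta> * \<tau>min * \<zeta> * sqrt (real K))" .
    show "1 / real K *
      (\<Sum>k<K. \<integral>s. (norm (grad_f (x k s) + transpose (J (x k s)) *v y_true k s))\<^sup>2 \<partial>P)
      \<le> 2 * \<kappa>\<^sub>H\<^sup>2 * \<kappa>\<^sub>2 / (\<nu> * \<eta> * \<tau>min * \<zeta> * sqrt (real K))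
        + 4 * \<kappa>\<^sub>2 * \<kappa>\<^sub>H\<^sup>2 * \<kappa>\<^sub>0 * \<kappa>\<^sub>J\<^sup>2 * \<kappa>\<^sub>c / (\<nu> * \<sigma> * \<kappa>\<^sub>v * \<sigma>\<^sub>J\<^sup>2 * \<zeta> * real K)"
      using divide_right_mono[OF SQ, of "real K"]
      unfolding res_exp add_divide_distrib 1 by (simp add: mult_ac)
  qed
qed

end
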